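(* Let $n\geq m\geq 2$ be integers and let $M$ be the smallest integer $k$ such that $\binom{k+1}{2}\geq m+n$. Then the maximum likelihood threshold of the complete bipartite graph $K_{m,n}$ (with color classes of sizes $m$ and $n$) equals $\min\{M,\,m+1\}$.
   Context: For a simple graph $H=(V,E)$ with vertex set $V=[N]$, let $\mathrm{Sym}_N$ be the space of real symmetric $N\times N$ matrices. Let $\pi_H:\mathrm{Sym}_N\to\mathbb{R}^N\oplus\mathbb{R}^E$ be the coordinate projection $(a_{ij})\mapsto((a_{ii})_{i\in[N]},(a_{ij})_{\{i,j\}\in E})$. Let $V_r\subset\mathrm{Sym}_N$ be the variety of symmetric matrices of rank at most $r$. The maximum likelihood threshold $\mathrm{mlt}(H)$ is the smallest integer $r$ such that for almost all positive semidefinite matrices $A$ of rank $r$ there is a positive definite $P$ with $\pi_H(A)=\pi_H(P)$. Here "almost all" means that the exceptional set of positive semidefinite rank-$r$ matrices is contained in a proper algebraic subvariety of $V_r$. *)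

theory Defs
  imports "HOL-Analysis.Analysis"
begin

text \<open>
  A simple graph on the vertex set \<open>'v\<close> (a finite type, playing the role of \<open>[N]\<close>) is given by
  its set of edges, which are two-element sets of vertices.
\<close>

definition simple_graph :: "'v set set \<Rightarrow> bool"
  where "simple_graph E \<longleftrightarrow> (\<forall>e\<in>E. card e = 2)"

definition complete_bipartite :: "'v set \<Rightarrow> 'v set \<Rightarrow> 'v set set"
  where "complete_bipartite X Y = {{x, y} | x y. x \<in> X \<and> y \<in> Y}"

definition Sym :: "(real^'v^'v) set"
  where "Sym = {A. transpose A = A}"

definition pos_semidef :: "real^'v^'v \<Rightarrow> bool"
  where "pos_semidef A \<longleftrightarrow> A \<in> Sym \<and> (\<forall>x. 0 \<le> x \<bullet> (A *v x))"

definition pos_def :: "real^'v^'v \<Rightarrow> bool"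
  where "pos_def A \<longleftrightarrow> A \<in> Sym \<and> (\<forall>x. x \<noteq> 0 \<longrightarrow> 0 < x \<bullet> (A *v x))"

text \<open>
  The coordinate projection onto the diagonal and the edge entries. The edge coordinates are
  indexed by both orientations of each edge; on \<open>Sym\<close> the two orientations carry the same value,
  so this is the same datum as a vector indexed by the unordered edges.
\<close>

definition graph_proj ::
    "'v set set \<Rightarrow> real^'v^'v \<Rightarrow> (real^'v) \<times> ('v \<times> 'v \<Rightarrow> real)"
  where "graph_proj E A =
    (\<chi> i. A $ i $ i, restrict (\<lambda>(i, j). A $ i $ j) {(i, j). {i, j} \<in> E})"

definition rank_variety :: "nat \<Rightarrow> (real^'v^'v) set"
  where "rank_variety r = {A \<in> Sym. rank A \<le> r}"

definition algebraic_set :: "'a::euclidean_space set \<Rightarrow> bool"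
  where "algebraic_set W \<longleftrightarrow>
    (\<exists>F. (\<forall>f\<in>F. real_polynomial_function f) \<and> W = {x. \<forall>f\<in>F. f x = 0})"

definition almost_all_psd_rank :: "nat \<Rightarrow> (real^'v^'v \<Rightarrow> bool) \<Rightarrow> bool"
  where "almost_all_psd_rank r Q \<longleftrightarrow>
    (\<exists>W. algebraic_set W \<and> W \<subset> rank_variety r \<and>
         {A. pos_semidef A \<and> rank A = r \<and> \<not> Q A} \<subseteq> W)"

definition mlt :: "'v::finite set set \<Rightarrow> nat"
  where "mlt E =
    (LEAST r. almost_all_psd_rank r
       (\<lambda>A::real^'v^'v. \<exists>P. pos_def P \<and> graph_proj E A = graph_proj E P))"

lemma simple_graph_complete_bipartite:
  "X \<inter> Y = {} \<Longrightarrow> simple_graph (complete_bipartite X Y)"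
  by (fastforce simp: simple_graph_def complete_bipartite_def card_2_iff)

lemma graph_proj_eq_iff:
  "graph_proj E A = graph_proj E B \<longleftrightarrow>
     (\<forall>i. A $ i $ i = B $ i $ i) \<and> (\<forall>i j. {i, j} \<in> E \<longrightarrow> A $ i $ j = B $ i $ j)"
  by (auto simp: graph_proj_def vec_eq_iff fun_eq_iff restrict_def)

lemma pos_semidef_full_rank_imp_pos_def:
  fixes A :: "real^'v^'v"
  assumes psd: "pos_semidef A" and full: "rank A = CARD('v)"
  shows "pos_def A"
  unfolding pos_def_def
proof (intro conjI allI impI)
  show sym: "A \<in> Sym" using psd by (simp add: pos_semidef_def)
  have nonneg: "0 \<le> x \<bullet> (A *v x)" for x using psd by (simp add: pos_semidef_def)
  fix x :: "real^'v" assume "x \<noteq> 0"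
  define y where "y = A *v x"
  have "inj ((*v) A)" using full by (simp add: full_rank_injective)
  then have "y \<noteq> 0" using \<open>x \<noteq> 0\<close> unfolding y_def
    by (metis inj_eq matrix_vector_mult_0_right)
  then have yy: "0 < y \<bullet> y" by simp
  have xy: "x \<bullet> (A *v y) = y \<bullet> y"
    using sym by (simp add: Sym_def y_def dot_lmul_matrix[symmetric])
      (metis transpose_matrix_vector)
  have expand: "(x - t *\<^sub>R y) \<bullet> (A *v (x - t *\<^sub>R y)) =
      x \<bullet> (A *v x) - 2 * t * (y \<bullet> y) + t\<^sup>2 * (y \<bullet> (A *v y))" for t
    by (simp add: matrix_vector_mult_diff_distrib matrix_vector_mult_scaleR inner_diff_left
        inner_diff_right xy flip: y_def) (simp add: power2_eq_square algebra_simps)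
  show "0 < x \<bullet> (A *v x)"
  proof (rule ccontr)
    assume "\<not> ?thesis"
    then have zero: "x \<bullet> (A *v x) = 0" using nonneg[of x] by linarith
    define c where "c = y \<bullet> (A *v y)"
    have ge: "0 \<le> t\<^sup>2 * c - 2 * t * (y \<bullet> y)" for t
      using nonneg[of "x - t *\<^sub>R y"] unfolding expand c_def zero by simp
    have "0 \<le> c" using nonneg[of y] by (simp add: c_def)
    define t where "t = (y \<bullet> y) / (c + 1)"
    have "0 < t" "t * c \<le> y \<bullet> y"
      using yy \<open>0 \<le> c\<close> by (auto simp: t_def field_simps)
    then have "t * (t * c) \<le> t * (y \<bullet> y)" "0 < t * (y \<bullet> y)" using yy by auto
    then show False using ge[of t] by (simp add: power2_eq_square algebra_simps)
  qed
qed

text \<open>The set over which \<open>mlt\<close> takes the minimum is nonempty: it contains \<open>N\<close>.\<close>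

lemma almost_all_psd_rank_full:
  "almost_all_psd_rank CARD('v)
     (\<lambda>A::real^'v^'v. \<exists>P. pos_def P \<and> graph_proj E A = graph_proj E P)"
  unfolding almost_all_psd_rank_def
proof (intro exI[of _ "{}"] conjI)
  show "algebraic_set ({} :: (real^'v^'v) set)"
    unfolding algebraic_set_def by (rule exI[of _ "{\<lambda>_. 1}"]) auto
  have "0 \<in> (rank_variety CARD('v) :: (real^'v^'v) set)"
    by (simp add: rank_variety_def Sym_def transpose_def vec_eq_iff rank_0)
  then show "{} \<subset> (rank_variety CARD('v) :: (real^'v^'v) set)" by blast
qed (use pos_semidef_full_rank_imp_pos_def in blast)

end

theory Submission
  imports Defs
begin

text \<open>
  By convex duality a positive semidefinite \<open>A\<close> has a positive definite completion of its entries
  on the graph iff no nonzero positive semidefinite \<open>S\<close> supported on the diagonal and the edges (a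
  stress) satisfies \<open>S A = 0\<close>. For a complete bipartite graph, multiplying the rows of \<open>S A = 0\<close> by
  \<open>A\<close> gives \<open>\<Sum>x\<in>X. S\<^sub>x\<^sub>x a\<^sub>x a\<^sub>x\<^sup>T = \<Sum>y\<in>Y. S\<^sub>y\<^sub>y a\<^sub>y a\<^sub>y\<^sup>T\<close> for the rows \<open>a\<^sub>i\<close> of \<open>A\<close>
  (Bolker--Roth). If \<open>A\<close> is the Gram matrix of \<open>m + n\<close> generic vectors in \<open>\<real>\<^sup>r\<close> and
  \<open>m + n \<le> r(r+1)/2\<close>, the tensors \<open>v\<^sub>i v\<^sub>i\<^sup>T\<close> are independent, so \<open>S = 0\<close>; and if \<open>r = m + 1\<close>, no
  \<open>v\<^sub>y\<close> lies in the span of the \<open>v\<^sub>x\<close>, which again forces \<open>S = 0\<close>.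

  Conversely, every relation of this kind with nonnegative, not all zero weights extends to a stress. If
  \<open>r \<le> m\<close> and \<open>r(r+1)/2 < m + n\<close>, some configuration has a relation with all weights positive while
  its tensors span the symmetric matrices. The relation then persists under perturbation, so that the
  matrices without completion are Zariski dense in the variety of rank at most \<open>r\<close>.
\<close>

subsection \<open>Positive semidefinite matrices and rank\<close>

definition outer :: "real^'n \<Rightarrow> real^'n^'n"
  where "outer a = (\<chi> i j. a $ i * a $ j)"

lemma outer_mult_vec: "outer a *v x = (a \<bullet> x) *\<^sub>R a"
  by (simp add: outer_def matrix_vector_mult_def inner_vec_def vec_eq_iff sum_distrib_right
      sum_distrib_left mult_ac)

lemma outer_in_Sym [simp]: "outer a \<in> Sym"
  by (simp add: Sym_def outer_def transpose_def vec_eq_iff mult.commute)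

lemma outer_0 [simp]: "outer 0 = 0"
  by (simp add: outer_def vec_eq_iff)

lemma matrix_vector_mult_sum_left:
  fixes M :: "'k \<Rightarrow> real^'n^'m"
  shows "(\<Sum>k\<in>K. M k) *v x = (\<Sum>k\<in>K. M k *v x)"
  by (induction K rule: infinite_finite_induct) (auto simp: matrix_vector_mult_add_rdistrib)

lemma inner_outer:
  fixes S :: "real^'n^'n"
  shows "S \<bullet> outer u = u \<bullet> (S *v u)"
  by (simp add: outer_def matrix_vector_mult_def inner_vec_def sum_distrib_left mult_ac)

lemma Sym_swap: "A \<in> Sym \<Longrightarrow> A $ i $ j = A $ j $ i"
  by (metis (mono_tags) Sym_def mem_Collect_eq transpose_def vec_lambda_beta)

lemma SymI: "(\<And>i j. A $ i $ j = A $ j $ i) \<Longrightarrow> A \<in> Sym"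
  by (simp add: Sym_def transpose_def vec_eq_iff)

lemma Sym_sum: "(\<And>k. k \<in> K \<Longrightarrow> M k \<in> Sym) \<Longrightarrow> (\<Sum>k\<in>K. M k) \<in> Sym"
  by (rule SymI) (simp add: Sym_swap)

lemma inner_Sym_mult: "A \<in> Sym \<Longrightarrow> x \<bullet> (A *v y) = (A *v x) \<bullet> y"
  by (metis (mono_tags, lifting) Sym_def dot_lmul_matrix mem_Collect_eq transpose_matrix_vector)

text \<open>With \<open>y = A *v x\<close>, moving from \<open>x\<close> to \<open>x - t y\<close>
  changes the quadratic form by \<open>- 2 t (y \<bullet> y)\<close> to first order, so a small
  positive \<open>t\<close> would make it negative unless \<open>y = 0\<close>.\<close>

lemma pos_semidef_quadratic_zero:
  assumes psd: "pos_semidef A" and zero: "x \<bullet> (A *v x) = 0"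
  shows "A *v x = 0"
proof (rule ccontr)
  assume nz: "A *v x \<noteq> 0"
  define y where "y = A *v x"
  have sym: "A \<in> Sym" and nonneg: "\<And>x. 0 \<le> x \<bullet> (A *v x)"
    using psd by (auto simp: pos_semidef_def)
  have yy: "0 < y \<bullet> y" using nz by (simp add: y_def)
  define c where "c = y \<bullet> (A *v y)"
  have xy: "x \<bullet> (A *v y) = y \<bullet> y" by (simp add: inner_Sym_mult sym y_def)
  have ge: "0 \<le> t\<^sup>2 * c - 2 * t * (y \<bullet> y)" for t
  proof -
    have "(x - t *\<^sub>R y) \<bullet> (A *v (x - t *\<^sub>R y)) = t\<^sup>2 * c - 2 * t * (y \<bullet> y)"
      using zero by (simp add: matrix_vector_mult_diff_distrib matrix_vector_mult_scaleR
          inner_diff_left inner_diff_right xy flip: y_def c_def)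
        (simp add: power2_eq_square algebra_simps)
    then show ?thesis using nonneg[of "x - t *\<^sub>R y"] by simp
  qed
  have c0: "0 \<le> c" using nonneg[of y] by (simp add: c_def)
  \<comment> \<open>The summand 1 covers the case \<open>c = 0\<close>;
    \<open>t * c \<le> y \<bullet> y\<close> then bounds the form by
    \<open>- t * (y \<bullet> y)\<close>.\<close>
  define t where "t = (y \<bullet> y) / (c + 1)"
  have t: "0 < t" "t * c \<le> y \<bullet> y"
    using yy c0 by (auto simp: t_def field_simps)
  then have "t * (t * c) \<le> t * (y \<bullet> y)" "0 < t * (y \<bullet> y)" using yy by auto
  then show False using ge[of t] by (simp add: power2_eq_square algebra_simps)
qed

lemma pos_semidef_outer: "pos_semidef (outer a)"
  by (simp add: pos_semidef_def outer_mult_vec inner_commute)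

lemma pos_semidef_sum: "(\<And>k. k \<in> K \<Longrightarrow> pos_semidef (M k)) \<Longrightarrow> pos_semidef (\<Sum>k\<in>K. M k)"
  by (simp add: pos_semidef_def Sym_sum matrix_vector_mult_sum_left inner_sum_right sum_nonneg)

lemma rank_add_le:
  fixes A B :: "real^'n^'m"
  shows "rank (A + B) \<le> rank A + rank B"
proof -
  have "range ((*v) (A + B)) \<subseteq> {x + y |x y. x \<in> range ((*v) A) \<and> y \<in> range ((*v) B)}"
    by (auto simp: matrix_vector_mult_add_rdistrib)
  then have "rank (A + B) \<le> dim {x + y |x y. x \<in> range ((*v) A) \<and> y \<in> range ((*v) B)}"
    unfolding rank_dim_range by (rule dim_subset)
  also have "\<dots> \<le> rank A + rank B"
    unfolding rank_dim_range
    by (subst dim_sums_Int[symmetric]) (auto intro!: linear_subspace_image)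
  finally show ?thesis .
qed

lemma rank_le_dim:
  fixes A :: "real^'n^'m"
  assumes "\<And>x. A *v x \<in> L"
  shows "rank A \<le> dim L"
  unfolding rank_dim_range using assms by (intro dim_subset) auto

lemma rank_outer_le: "rank (outer a) \<le> 1"
proof -
  have "rank (outer a) \<le> dim (span {a})"
    by (rule rank_le_dim) (simp add: outer_mult_vec span_base span_scale)
  also have "\<dots> \<le> 1" by (metis dim_insert dim_singleton dim_span le_refl zero_le_one)
  finally show ?thesis .
qed

lemma rank_sum_outer_le:
  assumes "finite K" shows "rank (\<Sum>k\<in>K. outer (u k)) \<le> card K"
  using assms
proof (induction K rule: finite_induct)
  case (insert k K)
  then show ?case using rank_add_le[of "outer (u k)" "\<Sum>k\<in>K. outer (u k)"] rank_outer_le[of "u k"]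
    by simp
qed simp

text \<open>Symmetric elimination: subtracting \<open>(A x) (A x)^T / (x \<bullet> A x)\<close>
  keeps the matrix positive semidefinite and lowers its rank. Read by vertices, the entries
  \<open>u k $ i\<close> are the coordinates of Gram vectors for \<open>A\<close>.\<close>

lemma pos_semidef_eq_sum_outer:
  assumes "pos_semidef A" "rank A \<le> r"
  shows "\<exists>u. A = (\<Sum>k<r. outer (u k))"
  using assms
proof (induction r arbitrary: A)
  case 0
  then show ?case by (simp add: rank_eq_0)
next
  case (Suc r)
  have sym: "A \<in> Sym" and nonneg: "\<And>x. 0 \<le> x \<bullet> (A *v x)"
    using Suc.prems by (auto simp: pos_semidef_def)
  show ?case
  proof (cases "A = 0")
    case True
    then show ?thesis by (intro exI[of _ "\<lambda>_. 0"]) simp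
  next
    case False
    then obtain x where x: "A *v x \<noteq> 0" by (metis matrix_eq matrix_vector_mult_0)
    define q where "q = x \<bullet> (A *v x)"
    have q: "q > 0" using nonneg[of x] pos_semidef_quadratic_zero[OF Suc.prems(1), of x] x
      unfolding q_def by linarith
    define y where "y = (1 / sqrt q) *\<^sub>R (A *v x)"
    have y: "outer y *v z = ((A *v x) \<bullet> z / q) *\<^sub>R (A *v x)" for z
      using q by (simp add: outer_mult_vec y_def)
    have *: "(A - outer y) *v z = A *v (z - ((A *v x) \<bullet> z / q) *\<^sub>R x)" for z
      by (simp add: matrix_vector_mult_diff_rdistrib y matrix_vector_mult_diff_distrib
          matrix_vector_mult_scaleR)
    have orth: "x \<bullet> ((A - outer y) *v z) = 0" for z
      using q unfolding matrix_vector_mult_diff_rdistrib y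
      by (simp add: inner_diff_right inner_Sym_mult[OF sym] flip: q_def)
        (simp add: q_def inner_commute)
    have "pos_semidef (A - outer y)"
      unfolding pos_semidef_def
    proof (intro conjI allI)
      show "A - outer y \<in> Sym"
        by (rule SymI) (simp add: Sym_swap[OF sym] Sym_swap[OF outer_in_Sym])
      fix z
      \<comment> \<open>\<open>w\<close> differs from \<open>z\<close> by a multiple of
        \<open>x\<close>, to which the range of \<open>A - outer y\<close> is orthogonal; so the new
        form at \<open>z\<close> is the old form at \<open>w\<close>.\<close>
      define w where "w = z - ((A *v x) \<bullet> z / q) *\<^sub>R x"
      have "z \<bullet> ((A - outer y) *v z) = w \<bullet> ((A - outer y) *v z)"
        using orth[of z] by (simp add: w_def inner_diff_left)
      also have "\<dots> = w \<bullet> (A *v w)" by (simp add: * w_def)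
      finally show "0 \<le> z \<bullet> ((A - outer y) *v z)" using nonneg by simp
    qed
    moreover have "rank (A - outer y) \<le> r"
    proof -
      have "range ((*v) (A - outer y)) \<subseteq> range ((*v) A)" using * by auto
      \<comment> \<open>The smaller range is orthogonal to \<open>x\<close>, whereas
        \<open>x \<bullet> (A *v x) = q > 0\<close>.\<close>
      moreover have "A *v x \<notin> range ((*v) (A - outer y))"
        using orth q by (auto simp: q_def)
      ultimately have "range ((*v) (A - outer y)) \<subset> range ((*v) A)" by blast
      then have "rank (A - outer y) < rank A"
        unfolding rank_dim_range
        by (intro dim_psubset) (auto simp: span_eq_iff[THEN iffD2] linear_subspace_image)
      then show ?thesis using Suc.prems by simp
    qed
    ultimately obtain u where u: "A - outer y = (\<Sum>k<r. outer (u k))" using Suc.IH by blast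
    then have "A = (\<Sum>k<Suc r. outer ((u(r := y)) k))" by (simp add: algebra_simps)
    then show ?thesis by blast
  qed
qed

lemma orthogonal_projection_matrix:
  fixes L :: "(real^'n) set"
  assumes "subspace L"
  obtains P where "P \<in> Sym" "\<And>x. P *v x \<in> L" "\<And>x. x \<in> L \<Longrightarrow> P *v x = x"
proof -
  obtain B where B: "B \<subseteq> L" "pairwise orthogonal B" "\<And>x. x \<in> B \<Longrightarrow> norm x = 1"
    "independent B" "span B = L"
    using orthonormal_basis_subspace[OF assms] by metis
  have fin: "finite B" using B(4) independent_imp_finite by blast
  define P where "P = (\<Sum>b\<in>B. outer b)"
  have P: "P *v x = (\<Sum>b\<in>B. (b \<bullet> x) *\<^sub>R b)" for x
    by (simp add: P_def matrix_vector_mult_sum_left outer_mult_vec)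
  show ?thesis
  proof
    show "P \<in> Sym" by (simp add: P_def Sym_sum)
    show "P *v x \<in> L" for x
      unfolding P using B(5) by (metis (no_types, lifting) span_base span_scale span_sum)
    fix x assume "x \<in> L"
    then have "x \<in> span B" using B by simp
    then show "P *v x = x"
    proof (induction rule: span_induct)
      case base
      show ?case by (auto simp: subspace_def matrix_vector_right_distrib matrix_vector_mult_scaleR)
    next
      case (step a)
      have "(\<Sum>b\<in>B. (b \<bullet> a) *\<^sub>R b) = (\<Sum>b\<in>B. if b = a then a else 0)"
        using B(2,3) step
        by (intro sum.cong) (auto simp: pairwise_def orthogonal_def dot_square_norm)
      then show ?case using step fin by (simp add: P)
    qed
  qed
qed

text \<open>The range is the orthogonal complement of the kernel: the residual of \<open>a\<close>
  after projection onto the range lies in the kernel, hence is orthogonal to \<open>a\<close> and to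
  itself.\<close>

lemma range_Sym:
  fixes A :: "real^'n^'n"
  assumes "A \<in> Sym" "\<And>x. A *v x = 0 \<Longrightarrow> a \<bullet> x = 0"
  shows "\<exists>w. A *v w = a"
proof -
  obtain P where P: "P \<in> Sym" "\<And>x. P *v x \<in> range ((*v) A)"
    "\<And>x. x \<in> range ((*v) A) \<Longrightarrow> P *v x = x"
    by (rule orthogonal_projection_matrix[of "range ((*v) A)"])
      (auto intro: linear_subspace_image)
  define x where "x = a - P *v a"
  have orth: "x \<bullet> (A *v y) = 0" for y
    using inner_Sym_mult[OF P(1), of a "A *v y"] P(3)[of "A *v y"]
    by (simp add: x_def inner_diff_left)
  then have "A *v x = 0"
    using inner_Sym_mult[OF assms(1), of x "A *v x"] by simp
  then have "a \<bullet> x = 0" using assms(2) by blast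
  moreover have "(P *v a) \<bullet> x = 0" using orth P(2)[of a] by (auto simp: inner_commute)
  ultimately have "x \<bullet> x = 0" by (simp add: x_def inner_diff_left)
  then have "a = P *v a" by (simp add: x_def)
  then show ?thesis using P(2)[of a] by (metis image_iff)
qed

text \<open>Kernel and range are orthogonal, so adding the projection onto the kernel makes
  \<open>A\<close> injective. The nonzero determinant then certifies a lower bound on the rank, also
  for matrices near \<open>A\<close>.\<close>

lemma rank_complement_Sym:
  fixes A :: "real^'n^'n"
  assumes "A \<in> Sym"
  obtains R where "rank R + rank A \<le> CARD('n)" "det (A + R) \<noteq> 0"
proof -
  define L where "L = {x. A *v x = 0}"
  have L: "subspace L"
    by (auto simp: L_def subspace_def matrix_vector_right_distrib matrix_vector_mult_scaleR)
  obtain P where P: "P \<in> Sym" "\<And>x. P *v x \<in> L" "\<And>x. x \<in> L \<Longrightarrow> P *v x = x"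
    using orthogonal_projection_matrix[OF L] by blast
  have orth: "x \<bullet> (A *v y) = 0" if "x \<in> L" for x y
    using that by (simp add: inner_Sym_mult[OF assms] L_def)
  show ?thesis
  proof
    have "dim L + rank A = dim (L \<union> range ((*v) A))"
      unfolding rank_dim_range by (rule dim_orthogonal_sum[symmetric]) (use orth in auto)
    also have "\<dots> \<le> CARD('n)"
      by (rule dim_subset_UNIV_cart)
    finally show "rank P + rank A \<le> CARD('n)" using rank_le_dim[OF P(2)] by simp
    have "x = 0" if "(A + P) *v x = 0" for x
    proof -
      have eq: "A *v x = - (P *v x)"
        using that by (simp add: matrix_vector_mult_add_rdistrib add_eq_0_iff2)
      have "(P *v x) \<bullet> (A *v x) = 0" using orth P(2) by blast
      then have "P *v x = 0" by (simp add: eq)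
      then have "x \<in> L" using eq by (simp add: L_def)
      then show "x = 0" using P(3)[of x] \<open>P *v x = 0\<close> by simp
    qed
    then show "det (A + P) \<noteq> 0"
      by (meson invertible_det_nz invertible_left_inverse matrix_left_invertible_ker)
  qed
qed

subsection \<open>Polynomials and the rank variety\<close>

lemma real_polynomial_function_entry:
  "real_polynomial_function (\<lambda>A::real^'n^'m. A $ i $ j)"
  by (intro real_polynomial_function.intros(1)
      bounded_linear_compose[OF bounded_linear_vec_nth bounded_linear_vec_nth])

lemma real_polynomial_function_det:
  fixes M :: "'a::real_normed_vector \<Rightarrow> real^'n^'n"
  assumes "\<And>i j. real_polynomial_function (\<lambda>x. M x $ i $ j)"
  shows "real_polynomial_function (\<lambda>x. det (M x))"
  unfolding det_def
  by (intro real_polynomial_function_sum real_polynomial_function.intros(4)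
      real_polynomial_function.intros(2) real_polynomial_function_prod assms) auto

lemma polynomial_function_matrix:
  fixes M :: "'a::real_normed_vector \<Rightarrow> real^'n^'m"
  assumes "\<And>i j. real_polynomial_function (\<lambda>x. M x $ i $ j)"
  shows "polynomial_function M"
  unfolding polynomial_function_iff_Basis_inner
  using assms by (auto simp: Basis_vec_def inner_axis)

lemma real_polynomial_function_eq_0:
  fixes f :: "real \<Rightarrow> real"
  assumes "real_polynomial_function f" "infinite {x. f x = 0}"
  shows "f t = 0"
proof -
  obtain a n where f: "f = (\<lambda>x. \<Sum>i\<le>n. a i * x ^ i)"
    using real_polynomial_function_imp_sum[OF assms(1)] by blast
  then have "\<forall>i\<le>n. a i = 0" using assms(2) polyfun_finite_roots[of a n] by (simp add: f)
  then show ?thesis by (simp add: f)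
qed

lemma det_add_eq_0:
  fixes A R :: "real^'n^'n"
  assumes "rank R + rank A < CARD('n)"
  shows "det (A + R) = 0"
  using rank_add_le[of A R] assms by (simp add: det_eq_0_rank)

text \<open>The minors are replaced by the polynomials \<open>A \<mapsto> det (A + R)\<close> with \<open>rank R < N - r\<close>: if
  \<open>rank A > r\<close>, take \<open>R\<close> to be the orthogonal projection onto the kernel of \<open>A\<close>.\<close>

lemma algebraic_set_rank_variety_zeros:
  fixes g :: "real^'n^'n \<Rightarrow> real"
  assumes "real_polynomial_function g"
  shows "algebraic_set {A \<in> rank_variety r. g A = 0}"
proof -
  define F where "F = {g} \<union> {\<lambda>A. A $ i $ j - A $ j $ i |i j. True}
    \<union> {\<lambda>A. det (A + R) |R :: real^'n^'n. rank R + r < CARD('n)}"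
  have "real_polynomial_function f" if "f \<in> F" for f
  proof -
    have "real_polynomial_function (\<lambda>A. det (A + R))" for R :: "real^'n^'n"
      by (rule real_polynomial_function_det)
        (auto intro: real_polynomial_function_entry)
    then show ?thesis
      using that assms unfolding F_def
      by (auto intro: real_polynomial_function_entry)
  qed
  moreover have "A \<in> rank_variety r \<and> g A = 0 \<longleftrightarrow> (\<forall>f\<in>F. f A = 0)" for A
  proof
    assume A: "A \<in> rank_variety r \<and> g A = 0"
    then have "A \<in> Sym" "rank A \<le> r" by (auto simp: rank_variety_def)
    then show "\<forall>f\<in>F. f A = 0"
      using A unfolding F_def by (auto simp: Sym_swap intro!: det_add_eq_0)
  next
    assume *: "\<forall>f\<in>F. f A = 0"
    have "(\<lambda>A. A $ i $ j - A $ j $ i) \<in> F" for i j unfolding F_def by blast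
    with * have "A $ i $ j = A $ j $ i" for i j by force
    then have sym: "A \<in> Sym" by (rule SymI)
    obtain R where R: "rank R + rank A \<le> CARD('n)" "det (A + R) \<noteq> 0"
      using rank_complement_Sym[OF sym] by blast
    have "(\<lambda>A. det (A + R)) \<in> F" if "rank R + r < CARD('n)" using that unfolding F_def by blast
    with * R(2) have "\<not> rank R + r < CARD('n)" by force
    then have "rank A \<le> r" using R(1) by linarith
    then show "A \<in> rank_variety r \<and> g A = 0"
      using sym * by (simp add: rank_variety_def F_def)
  qed
  ultimately show ?thesis unfolding algebraic_set_def by (intro exI[of _ F]) auto
qed

text \<open>One polynomial suffices: its zeros in the rank variety contain all exceptions, and a
  single point \<open>A0\<close> of the variety shows that they are a proper subset.\<close>

lemma almost_all_psd_rankI: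
  assumes "real_polynomial_function g"
    and "\<And>A. pos_semidef A \<Longrightarrow> rank A = r \<Longrightarrow> g A \<noteq> 0 \<Longrightarrow> Q A"
    and "A0 \<in> rank_variety r" "g A0 \<noteq> 0"
  shows "almost_all_psd_rank r Q"
  unfolding almost_all_psd_rank_def
proof (intro exI[of _ "{A \<in> rank_variety r. g A = 0}"] conjI)
  show "algebraic_set {A \<in> rank_variety r. g A = 0}"
    using assms(1) by (rule algebraic_set_rank_variety_zeros)
  show "{A. pos_semidef A \<and> rank A = r \<and> \<not> Q A} \<subseteq> {A \<in> rank_variety r. g A = 0}"
    using assms(2) by (auto simp: rank_variety_def pos_semidef_def)
qed (use assms in auto)

subsection \<open>Stresses and positive definite completions\<close>

text \<open>The diagonal is free because \<open>graph_proj\<close> retains it: pairing with such an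
  \<open>S\<close> only sees the projected entries.\<close>

definition supported_on :: "'v set set \<Rightarrow> real^'v^'v \<Rightarrow> bool"
  where "supported_on E S \<longleftrightarrow> (\<forall>i j. i \<noteq> j \<longrightarrow> {i, j} \<notin> E \<longrightarrow> S $ i $ j = 0)"

lemma inner_eq_if_graph_proj_eq:
  assumes "supported_on E S" "graph_proj E A = graph_proj E P"
  shows "S \<bullet> A = S \<bullet> P"
proof -
  have "S $ i $ j * A $ i $ j = S $ i $ j * P $ i $ j" for i j
    using assms unfolding graph_proj_eq_iff supported_on_def
    by (cases "i = j"; cases "{i, j} \<in> E") auto
  then show ?thesis unfolding inner_vec_def inner_real_def by presburger
qed

text \<open>Pairing with \<open>S\<close> gives the same value on \<open>A\<close> and on a
  completion \<open>P\<close>. It is 0 on \<open>A\<close>, but positive on a positive definite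
  \<open>P\<close>, since \<open>S\<close> is a nonzero sum of matrices
  \<open>outer (u k)\<close>.\<close>

lemma stress_imp_no_completion:
  assumes S: "pos_semidef S" "S \<noteq> 0" "supported_on E S" "S ** A = 0" and sym: "A \<in> Sym"
  shows "\<nexists>P. pos_def P \<and> graph_proj E A = graph_proj E P"
proof
  assume "\<exists>P. pos_def P \<and> graph_proj E A = graph_proj E P"
  then obtain P where P: "pos_def P" "graph_proj E A = graph_proj E P" by blast
  have "S \<bullet> A = (\<Sum>i\<in>UNIV. (S ** A) $ i $ i)"
    by (simp add: inner_vec_def matrix_matrix_mult_def Sym_swap[OF sym])
  then have 0: "S \<bullet> P = 0" using inner_eq_if_graph_proj_eq[OF S(3) P(2)] S(4) by simp
  obtain u where u: "S = (\<Sum>k<rank S. outer (u k))"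
    using pos_semidef_eq_sum_outer[OF S(1) order_refl] by blast
  have "(\<Sum>k<rank S. u k \<bullet> (P *v u k)) = P \<bullet> S"
    by (subst u) (simp add: inner_sum_right inner_outer)
  also have "\<dots> = 0" using 0 by (simp add: inner_commute)
  finally have "(\<Sum>k<rank S. u k \<bullet> (P *v u k)) = 0" .
  moreover have nn: "0 \<le> x \<bullet> (P *v x)" for x
    using P(1) by (cases "x = 0") (auto simp: pos_def_def less_imp_le)
  ultimately have "\<forall>k<rank S. u k \<bullet> (P *v u k) = 0"
    by (subst (asm) sum_nonneg_eq_0_iff) auto
  then have "\<forall>k<rank S. u k = 0" using P(1) unfolding pos_def_def by fastforce
  then have "S = 0" by (subst u) simp
  then show False using S(2) by blast
qed

text \<open>If the affine space of matrices with the prescribed entries misses the open cone of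
  positive definite ones, a hyperplane separates them, and its normal \<open>a\<close> is a nonzero
  stress.\<close>

lemma no_stress_imp_completion:
  fixes A :: "real^'v^'v"
  assumes psd: "pos_semidef A"
    and no: "\<And>S. pos_semidef S \<Longrightarrow> supported_on E S \<Longrightarrow> S ** A = 0 \<Longrightarrow> S = 0"
  shows "\<exists>P. pos_def P \<and> graph_proj E A = graph_proj E P"
proof (rule ccontr)
  assume none: "\<not> ?thesis"
  have symA: "A \<in> Sym" using psd by (simp add: pos_semidef_def)
  text \<open>Neither set is restricted to symmetric matrices: inside \<open>Sym\<close> the separating functional
    could be antisymmetric and hence carry no information.\<close>
  define PD where "PD = {B::real^'v^'v. \<forall>x. x \<noteq> 0 \<longrightarrow> 0 < x \<bullet> (B *v x)}"
  define T where "T = {B::real^'v^'v. (\<forall>i. B $ i $ i = A $ i $ i) \<and>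
    (\<forall>i j. {i, j} \<in> E \<longrightarrow> B $ i $ j + B $ j $ i = A $ i $ j + A $ j $ i)}"
  have "convex PD"
    unfolding convex_def PD_def
  proof (clarsimp simp: matrix_vector_mult_add_rdistrib inner_add_right scaleR_matrix_vector_assoc[symmetric])
    fix B C :: "real^'v^'v" and u v :: real and x :: "real^'v"
    assume BC: "\<forall>x. x \<noteq> 0 \<longrightarrow> 0 < x \<bullet> (B *v x)" "\<forall>x. x \<noteq> 0 \<longrightarrow> 0 < x \<bullet> (C *v x)"
      and uv: "0 \<le> u" "0 \<le> v" "u + v = 1" and x: "x \<noteq> 0"
    have "0 < x \<bullet> (B *v x)" "0 < x \<bullet> (C *v x)" using BC x by auto
    moreover have "u > 0 \<or> v > 0" using uv by linarith
    ultimately show "0 < u * (x \<bullet> (B *v x)) + v * (x \<bullet> (C *v x))"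
      using uv by (metis add_nonneg_pos add_pos_nonneg less_imp_le mult_nonneg_nonneg mult_pos_pos)
  qed
  moreover have "convex T"
  proof -
    have "u * b + v * b' + (u * c + v * c') = a"
      if "b + c = a" "b' + c' = a" "u + v = 1" for u v b b' c c' a :: real
    proof -
      have "u * b + v * b' + (u * c + v * c') = u * (b + c) + v * (b' + c')"
        by (simp add: algebra_simps)
      also have "\<dots> = a" using that by (metis distrib_right mult_1)
      finally show ?thesis .
    qed
    moreover have "u * a + v * a = a" if "u + v = 1" for u v a :: real
      using that by (metis distrib_right mult_1)
    ultimately show ?thesis unfolding convex_def T_def by auto
  qed
  moreover have I_PD: "e *\<^sub>R mat 1 + outer x \<in> PD" if "e > 0" for e and x :: "real^'v"
    using that unfolding PD_def
    by (auto simp: matrix_vector_mult_add_rdistrib scaleR_matrix_vector_assoc[symmetric]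
        outer_mult_vec inner_add_right inner_commute intro!: add_pos_nonneg)
  moreover have "PD \<noteq> {}" using I_PD[of 1] by auto
  moreover have AT: "A \<in> T" by (simp add: T_def)
  moreover have "PD \<inter> T = {}"
  proof (rule ccontr)
    assume "PD \<inter> T \<noteq> {}"
    then obtain B where B: "B \<in> PD" "B \<in> T" by blast
    \<comment> \<open>Passing to the symmetric part changes neither the quadratic form nor the
      prescribed sums of opposite entries.\<close>
    define P where "P = (1/2) *\<^sub>R (B + transpose B)"
    have "x \<bullet> (P *v x) = x \<bullet> (B *v x)" for x
      by (simp add: P_def matrix_vector_mult_add_rdistrib scaleR_matrix_vector_assoc[symmetric]
          inner_add_right dot_lmul_matrix[symmetric] inner_commute)
    moreover have "P \<in> Sym" by (rule SymI) (simp add: P_def transpose_def)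
    ultimately have "pos_def P" using B(1) by (simp add: pos_def_def PD_def)
    moreover have "graph_proj E A = graph_proj E P"
      using B(2) unfolding graph_proj_eq_iff T_def P_def
      by (auto simp: transpose_def)
        (metis Sym_swap[OF symA] mult_2 nonzero_mult_div_cancel_left zero_neq_numeral)
    ultimately show False using none by blast
  qed
  ultimately obtain a b where ab: "a \<noteq> 0" "\<And>B. B \<in> T \<Longrightarrow> a \<bullet> B \<le> b" "\<And>B. B \<in> PD \<Longrightarrow> b \<le> a \<bullet> B"
    using separating_hyperplane_sets[of T PD] by blast
  \<comment> \<open>A linear functional bounded above on a full line is constant on it; the chosen
    \<open>t\<close> would give the value \<open>b + 1\<close>.\<close>
  have dir: "a \<bullet> K = 0" if K: "\<And>t. A + t *\<^sub>R K \<in> T" for K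
  proof (rule ccontr)
    assume nz: "a \<bullet> K \<noteq> 0"
    show False using ab(2)[OF K[of "(b - a \<bullet> A + 1) / (a \<bullet> K)"]] nz
      by (simp add: inner_add_right)
  qed
  define unit where "unit i j = (axis i (axis j 1) :: real^'v^'v)" for i j
  have unit: "a \<bullet> unit i j = a $ i $ j" for i j by (simp add: unit_def inner_axis)
  have unit_nth: "unit i j $ k $ l = (if k = i \<and> l = j then 1 else 0)" for i j k l
    by (simp add: unit_def axis_def)
  have "a \<in> Sym"
  proof (rule SymI)
    fix i j
    \<comment> \<open>Antisymmetric directions stay inside \<open>T\<close>, so \<open>a\<close> is
      orthogonal to them and therefore symmetric.\<close>
    define K where "K = unit i j - unit j i"
    have "K $ k $ l + K $ l $ k = 0" for k l
      unfolding K_def vector_minus_component unit_nth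
      by (cases "k = i"; cases "l = j"; cases "k = j"; cases "l = i") simp_all
    then have K: "K $ k $ l = - K $ l $ k" "K $ k $ k = 0" for k l
      by (metis eq_neg_iff_add_eq_0, metis add_cancel_right_right double_zero)
    have "A + t *\<^sub>R K \<in> T" for t
      unfolding T_def
    proof (intro CollectI conjI allI impI)
      fix k l
      show "(A + t *\<^sub>R K) $ k $ l + (A + t *\<^sub>R K) $ l $ k = A $ k $ l + A $ l $ k"
        unfolding vector_add_component vector_scaleR_component K(1)[of k l] by simp
    qed (simp add: K(2))
    then have "a \<bullet> (unit i j - unit j i) = 0"
      unfolding K_def[symmetric] by (rule dir)
    then show "a $ i $ j = a $ j $ i" unfolding inner_diff_right unit by linarith
  qed
  moreover have supp: "supported_on E a"
    unfolding supported_on_def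
  proof (intro allI impI)
    fix i j assume ij: "i \<noteq> j" "{i, j} \<notin> E"
    then have nE: "{j, i} \<notin> E" by (simp add: insert_commute)
    have "unit i j $ k $ k = 0" for k using ij by (simp add: unit_nth)
    moreover have "unit i j $ k $ l = 0" "unit i j $ l $ k = 0" if "{k, l} \<in> E" for k l
      using ij nE that by (auto simp: unit_nth)
    ultimately have "a \<bullet> unit i j = 0"
      by (intro dir) (simp add: T_def)
    then show "a $ i $ j = 0" unfolding unit .
  qed
  \<comment> \<open>The matrices \<open>e I + s x x^T\<close> lie in the cone for
    \<open>e > 0\<close>; let \<open>e\<close> tend to 0. Then \<open>s = 0\<close> yields
    \<open>b \<le> 0\<close>, and large \<open>s\<close> rules out a negative value of the form of
    \<open>a\<close>.\<close>
  moreover have lim: "b \<le> s * (x \<bullet> (a *v x))" if "s \<ge> 0" for s x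
  proof -
    have "b \<le> e * (a \<bullet> mat 1) + s * (x \<bullet> (a *v x))" if "e > 0" for e
      using ab(3)[OF I_PD[OF that, of "sqrt s *\<^sub>R x"]] \<open>s \<ge> 0\<close>
      by (simp add: inner_add_right inner_outer matrix_vector_mult_scaleR flip: mult.assoc)
    then have "\<forall>\<^sub>F e in at_right 0. b \<le> e * (a \<bullet> mat 1) + s * (x \<bullet> (a *v x))"
      by (auto intro: eventually_mono[OF eventually_at_right_less])
    moreover have "((\<lambda>e. e * (a \<bullet> mat 1) + s * (x \<bullet> (a *v x))) \<longlongrightarrow>
        0 * (a \<bullet> mat 1) + s * (x \<bullet> (a *v x))) (at_right 0)"
      by (intro tendsto_intros)
    ultimately show ?thesis
      using tendsto_lowerbound[OF _ _ trivial_limit_at_right_real] by fastforce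
  qed
  have b0: "b \<le> 0" using lim[of 0] by simp
  have nonneg: "0 \<le> x \<bullet> (a *v x)" for x
  proof (rule ccontr)
    assume "\<not> ?thesis"
    then have neg: "x \<bullet> (a *v x) < 0" by simp
    then have "b \<le> (b - 1) / (x \<bullet> (a *v x)) * (x \<bullet> (a *v x))"
      using b0 by (intro lim) (simp add: divide_nonpos_neg)
    then show False using neg by simp
  qed
  ultimately have psda: "pos_semidef a" by (simp add: pos_semidef_def)
  obtain u where u: "A = (\<Sum>k<rank A. outer (u k))"
    using pos_semidef_eq_sum_outer[OF psd order_refl] by blast
  have "(\<Sum>k<rank A. u k \<bullet> (a *v u k)) = a \<bullet> A"
    by (subst u) (simp add: inner_sum_right inner_outer)
  \<comment> \<open>The pairing of \<open>a\<close> with \<open>A\<close> is a sum of nonnegative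
    terms that is at most \<open>b \<le> 0\<close>, so every term vanishes and \<open>a\<close>
    annihilates each \<open>u k\<close>.\<close>
  also have "\<dots> \<le> 0" using ab(2)[OF AT] b0 by linarith
  finally have "(\<Sum>k<rank A. u k \<bullet> (a *v u k)) = 0"
    using nonneg by (meson order_antisym sum_nonneg)
  then have "\<forall>k<rank A. u k \<bullet> (a *v u k) = 0"
    using nonneg by (subst (asm) sum_nonneg_eq_0_iff) auto
  then have au: "\<forall>k<rank A. a *v u k = 0" using pos_semidef_quadratic_zero[OF psda] by blast
  have "(a ** A) *v x = 0" for x
  proof -
    have "A *v x = (\<Sum>k<rank A. (u k \<bullet> x) *\<^sub>R u k)"
      by (subst u) (simp add: matrix_vector_mult_sum_left outer_mult_vec)
    then have "(a ** A) *v x = (\<Sum>k<rank A. (u k \<bullet> x) *\<^sub>R (a *v u k))"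
      by (simp add: matrix_vector_mul_assoc[symmetric] matrix_vector_mult_scaleR
          linear_sum[OF matrix_vector_mul_linear])
    then show ?thesis using au by simp
  qed
  then have "a ** A = 0" by (simp add: matrix_eq)
  then show False using no psda supp ab(1) by blast
qed

subsection \<open>Stresses of complete bipartite graphs\<close>

lemma pos_semidef_diag_0:
  assumes "pos_semidef S" "S $ i $ i = 0"
  shows "S $ j $ i = 0"
proof -
  have "axis i 1 \<bullet> (S *v axis i 1) = 0"
    using assms(2) by (simp add: matrix_vector_mult_basis column_def inner_axis')
  then have "S *v axis i 1 = 0" by (rule pos_semidef_quadratic_zero[OF assms(1)])
  then show ?thesis by (simp add: matrix_vector_mult_basis column_def vec_eq_iff)
qed

lemma pos_semidef_diag_eq_0:
  "pos_semidef S \<Longrightarrow> (\<And>i. S $ i $ i = 0) \<Longrightarrow> S = 0"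
  by (simp add: vec_eq_iff pos_semidef_diag_0)

text \<open>The principal submatrix on \<open>insert y X\<close>, padded by an identity block to
  keep the type; its determinant is that principal minor of \<open>A\<close>.\<close>

definition border :: "'v set \<Rightarrow> 'v \<Rightarrow> real^'v^'v \<Rightarrow> real^'v^'v"
  where "border X y A = (\<chi> i j. if i \<in> insert y X \<and> j \<in> insert y X then A $ i $ j
    else if i = j then 1 else 0)"

context
  fixes X Y :: "'v::finite set"
  assumes disj: "X \<inter> Y = {}" and cover: "X \<union> Y = UNIV"
begin

lemma sum_bipartition: "(\<Sum>i\<in>UNIV. f i) = (\<Sum>i\<in>X. f i) + (\<Sum>i\<in>Y. f i)"
  for f :: "'v \<Rightarrow> 'b::comm_monoid_add"
  using disj cover by (metis finite_code sum.union_disjoint)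

lemma complete_bipartite_edge_iff:
  "{i, j} \<in> complete_bipartite X Y \<longleftrightarrow> (i \<in> X \<and> j \<in> Y) \<or> (i \<in> Y \<and> j \<in> X)"
  unfolding complete_bipartite_def by (auto simp: doubleton_eq_iff)

text \<open>In row \<open>i\<close> of \<open>S ** A = 0\<close> the support condition leaves, on
  the side of \<open>i\<close>, only the diagonal term.\<close>

lemma stress_row:
  assumes "supported_on (complete_bipartite X Y) S" "S ** A = 0"
  shows "i \<in> X \<Longrightarrow> S $ i $ i * A $ i $ l = - (\<Sum>j\<in>Y. S $ i $ j * A $ j $ l)"
    and "i \<in> Y \<Longrightarrow> S $ i $ i * A $ i $ l = - (\<Sum>j\<in>X. S $ i $ j * A $ j $ l)"
proof -
  have sum0: "(\<Sum>j\<in>X. S $ i $ j * A $ j $ l) + (\<Sum>j\<in>Y. S $ i $ j * A $ j $ l) = 0"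
  proof -
    have "(S ** A) $ i $ l = 0" using assms(2) by simp
    then show ?thesis by (simp add: matrix_matrix_mult_def sum_bipartition)
  qed
  have supp: "S $ i $ j = 0" if "i \<noteq> j" "(i \<in> X \<and> j \<in> X) \<or> (i \<in> Y \<and> j \<in> Y)" for j
    using assms(1) that disj unfolding supported_on_def complete_bipartite_edge_iff by blast
  have same: "(\<Sum>j\<in>Z. S $ i $ j * A $ j $ l) = S $ i $ i * A $ i $ l"
    if "i \<in> Z" "Z = X \<or> Z = Y" for Z
  proof -
    have "(\<Sum>j\<in>Z. S $ i $ j * A $ j $ l) = (\<Sum>j\<in>Z. if j = i then S $ i $ i * A $ i $ l else 0)"
      using supp that by (intro sum.cong) auto
    then show ?thesis using that by simp
  qed
  show "S $ i $ i * A $ i $ l = - (\<Sum>j\<in>Y. S $ i $ j * A $ j $ l)" if "i \<in> X"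
    using sum0 same[OF that] by simp
  show "S $ i $ i * A $ i $ l = - (\<Sum>j\<in>X. S $ i $ j * A $ j $ l)" if "i \<in> Y"
    using sum0 same[OF that] by simp
qed

text \<open>The diagonal entries of the Bolker--Roth relation say that the entrywise square of
  \<open>A\<close> annihilates the signed diagonal of \<open>S\<close>. If \<open>A\<close> is a
  Gram matrix of vectors, this square is the Gram matrix of their tensor squares.\<close>

lemma stress_eq_0_if_Hadamard_square_regular:
  fixes A S :: "real^'v^'v"
  assumes psd: "pos_semidef S" and supp: "supported_on (complete_bipartite X Y) S"
    and SA: "S ** A = 0" and sym: "A \<in> Sym"
    and det: "det (\<chi> i j. (A $ i $ j)\<^sup>2) \<noteq> 0"
  shows "S = 0"
proof -
  have symS: "S \<in> Sym" using psd by (simp add: pos_semidef_def)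
  define c where "c = (\<chi> i. if i \<in> X then S $ i $ i else - S $ i $ i)"
  define H where "H = (\<chi> i j. (A $ i $ j)\<^sup>2)"
  have "H *v c = 0"
  proof (rule vec_eq_iff[THEN iffD2], rule allI)
    fix k
    \<comment> \<open>Both one-sided sums equal minus the same double sum over \<open>X\<close> and
      \<open>Y\<close>, by symmetry of \<open>S\<close> and \<open>A\<close>.\<close>
    have "(\<Sum>x\<in>X. A $ k $ x * (S $ x $ x * A $ x $ k)) =
        - (\<Sum>x\<in>X. \<Sum>y\<in>Y. A $ k $ x * S $ x $ y * A $ y $ k)"
      using stress_row(1)[OF supp SA, of _ k] disj
      by (simp add: sum_distrib_left sum_negf mult.assoc)
    also have "\<dots> = - (\<Sum>y\<in>Y. \<Sum>x\<in>X. A $ k $ y * S $ y $ x * A $ x $ k)"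
      by (subst sum.swap) (simp add: Sym_swap[OF sym, of k] Sym_swap[OF symS, of _] mult_ac)
    also have "\<dots> = (\<Sum>y\<in>Y. A $ k $ y * (S $ y $ y * A $ y $ k))"
      using stress_row(2)[OF supp SA, of _ k] disj
      by (simp add: sum_distrib_left sum_negf mult.assoc)
    finally have eq: "(\<Sum>x\<in>X. A $ k $ x * (S $ x $ x * A $ x $ k)) =
        (\<Sum>y\<in>Y. A $ k $ y * (S $ y $ y * A $ y $ k))" .
    have "(H *v c) $ k = (\<Sum>x\<in>X. (A $ k $ x)\<^sup>2 * S $ x $ x) + (\<Sum>y\<in>Y. (A $ k $ y)\<^sup>2 * - S $ y $ y)"
      unfolding matrix_vector_mult_def H_def c_def
      using disj by (auto simp: sum_bipartition intro!: arg_cong2[where f = "(+)"] sum.cong)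
    also have "\<dots> = 0"
      using eq by (simp add: sum_negf power2_eq_square Sym_swap[OF sym, of _ k] mult_ac)
    finally show "(H *v c) $ k = 0 $ k" by simp
  qed
  then have "c = 0"
    using det unfolding H_def[symmetric]
    by (meson invertible_det_nz invertible_left_inverse matrix_left_invertible_ker)
  then have "S $ i $ i = 0" for i
    unfolding c_def vec_eq_iff by (auto dest: spec[of _ i] split: if_splits)
  then show ?thesis using pos_semidef_diag_eq_0[OF psd] by blast
qed

text \<open>Row \<open>y\<close> of \<open>S\<close> lives on \<open>insert y X\<close> and gives a
  kernel vector of the bordered matrix, so it vanishes. What remains of row \<open>x\<close> is
  \<open>S $ x $ x\<close> times a nonzero row of \<open>A\<close>.\<close>

lemma stress_eq_0_if_border_regular:
  assumes psd: "pos_semidef S" and supp: "supported_on (complete_bipartite X Y) S"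
    and SA: "S ** A = 0" and sym: "A \<in> Sym"
    and det: "\<And>y. y \<in> Y \<Longrightarrow> det (border X y A) \<noteq> 0" and "Y \<noteq> {}"
  shows "S = 0"
proof -
  have symS: "S \<in> Sym" using psd by (simp add: pos_semidef_def)
  have dy: "S $ y $ y = 0" if y: "y \<in> Y" for y
  proof -
    define c where "c = (\<chi> j. if j \<in> insert y X then S $ y $ j else 0)"
    have "border X y A *v c = 0"
    proof (rule vec_eq_iff[THEN iffD2], rule allI)
      fix k
      have yX: "y \<notin> X" using y disj by blast
      have "(border X y A *v c) $ k = (\<Sum>j\<in>insert y X. border X y A $ k $ j * S $ y $ j)"
        unfolding matrix_vector_mult_def c_def
        by (auto intro!: sum.mono_neutral_cong_right split: if_splits)
      also have "\<dots> = 0"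
      proof (cases "k \<in> insert y X")
        case True
        have "(\<Sum>j\<in>insert y X. border X y A $ k $ j * S $ y $ j) =
            (\<Sum>j\<in>insert y X. S $ y $ j * A $ j $ k)"
          using True by (intro sum.cong) (auto simp: border_def Sym_swap[OF sym, of k])
        also have "\<dots> = 0" using stress_row(2)[OF supp SA y, of k] yX by simp
        finally show ?thesis .
      next
        case False
        then show ?thesis by (intro sum.neutral) (auto simp: border_def)
      qed
      finally show "(border X y A *v c) $ k = 0 $ k" by simp
    qed
    then have "c = 0"
      using det[OF y] by (meson invertible_det_nz invertible_left_inverse matrix_left_invertible_ker)
    then have "c $ y = 0" by simp
    then show ?thesis by (simp add: c_def)
  qed
  have dx: "S $ x $ x = 0" if x: "x \<in> X" for x
  proof -
    obtain y where y: "y \<in> Y" using \<open>Y \<noteq> {}\<close> by blast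
    have eq: "S $ x $ x * A $ x $ l = 0" for l
      using stress_row(1)[OF supp SA x, of l] pos_semidef_diag_0[OF psd dy] by simp
    show ?thesis
    proof (rule ccontr)
      assume "S $ x $ x \<noteq> 0"
      then have "A $ x $ l = 0" for l using eq by simp
      then have "row x (border X y A) = 0"
        using x by (auto simp: row_def border_def vec_eq_iff)
      then show False using det[OF y] det_zero_row by blast
    qed
  qed
  show ?thesis
    using pos_semidef_diag_eq_0[OF psd] dx dy cover by blast
qed

text \<open>The off-diagonal blocks are \<open>- D\<^sub>X V\<^sub>X Q\<^sup>-\<^sup>1 V\<^sub>Y\<^sup>T D\<^sub>Y\<close>, where \<open>V\<close> has the rows of \<open>A\<close>
  and \<open>Q = V\<^sub>X\<^sup>T D\<^sub>X V\<^sub>X = V\<^sub>Y\<^sup>T D\<^sub>Y V\<^sub>Y\<close>; as \<open>Q\<close> may be singular, \<open>Q\<^sup>-\<^sup>1\<close> is replaced by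
  chosen preimages \<open>w\<close>.\<close>

lemma stress_exists:
  fixes A :: "real^'v^'v" and d :: "'v \<Rightarrow> real"
  assumes sym: "A \<in> Sym" and d: "\<And>i. 0 \<le> d i" "0 < d i0"
    and bal: "\<And>k l. (\<Sum>x\<in>X. d x * A $ x $ k * A $ x $ l) = (\<Sum>y\<in>Y. d y * A $ y $ k * A $ y $ l)"
  shows "\<exists>S. pos_semidef S \<and> S \<noteq> 0 \<and> supported_on (complete_bipartite X Y) S \<and> S ** A = 0"
proof -
  define Q where "Q = (\<chi> k l. \<Sum>x\<in>X. d x * A $ x $ k * A $ x $ l)"
  have QX: "Q *v z = (\<Sum>x\<in>X. (d x * (A $ x \<bullet> z)) *\<^sub>R A $ x)" for z
    by (simp add: vec_eq_iff Q_def matrix_vector_mult_def inner_vec_def sum_distrib_left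
        sum_distrib_right) (subst sum.swap, simp add: mult_ac)
  have QY: "Q *v z = (\<Sum>y\<in>Y. (d y * (A $ y \<bullet> z)) *\<^sub>R A $ y)" for z
    by (simp add: vec_eq_iff Q_def bal matrix_vector_mult_def inner_vec_def sum_distrib_left
        sum_distrib_right) (subst sum.swap, simp add: mult_ac)
  have symQ: "Q \<in> Sym" by (rule SymI) (simp add: Q_def mult_ac)
  have Qq: "z \<bullet> (Q *v z) = (\<Sum>x\<in>Z. d x * (A $ x \<bullet> z)\<^sup>2)" if "Z = X \<or> Z = Y" for z Z
  proof -
    have "Q *v z = (\<Sum>x\<in>Z. (d x * (A $ x \<bullet> z)) *\<^sub>R A $ x)" using that QX QY by metis
    then show ?thesis by (simp add: inner_sum_right power2_eq_square inner_commute mult.assoc)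
  qed
  \<comment> \<open>The form of \<open>Q\<close> is a weighted sum of squares over either side, so
    its kernel is orthogonal to every row of \<open>A\<close> with positive weight; such rows lie in
    the range of \<open>Q\<close>.\<close>
  have "\<exists>w. d i > 0 \<longrightarrow> Q *v w = A $ i" for i
  proof (cases "d i > 0")
    case True
    obtain Z where Z: "Z = X \<or> Z = Y" "i \<in> Z" using cover by blast
    have "A $ i \<bullet> z = 0" if "Q *v z = 0" for z
    proof -
      have "(\<Sum>x\<in>Z. d x * (A $ x \<bullet> z)\<^sup>2) = 0" using Qq[OF Z(1), of z] that by simp
      then have "\<forall>x\<in>Z. d x * (A $ x \<bullet> z)\<^sup>2 = 0"
        using d by (subst (asm) sum_nonneg_eq_0_iff) auto
      then show ?thesis using Z True by force
    qed
    then show ?thesis using range_Sym[OF symQ] by blast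
  qed auto
  then obtain w where w: "\<And>i. d i > 0 \<Longrightarrow> Q *v w i = A $ i" by metis
  have dw: "d i *\<^sub>R (Q *v w i) = d i *\<^sub>R A $ i" for i
    using d(1)[of i] w[of i] by (cases "d i = 0") auto
  define cross where "cross i j \<longleftrightarrow> (i \<in> X \<and> j \<in> Y) \<or> (i \<in> Y \<and> j \<in> X)" for i j
  define S where "S = (\<chi> i j. if i = j then d i
      else if cross i j then - (d i * d j * (w i \<bullet> (Q *v w j))) else 0)"
  have ncross: "\<not> cross i i" for i using disj by (auto simp: cross_def)
  have S_mult: "(\<Sum>j\<in>UNIV. S $ i $ j * f j) =
      d i * f i - (\<Sum>j | cross i j. d i * d j * (w i \<bullet> (Q *v w j)) * f j)" for i f
  proof -
    have "S $ i $ j * f j = (if j = i then d i * f i else 0) -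
        (if cross i j then d i * d j * (w i \<bullet> (Q *v w j)) * f j else 0)" for j
      using ncross by (auto simp: S_def)
    then show ?thesis by (simp add: sum_subtractf sum.If_cases)
  qed
  have crossSet: "{j. cross i j} = (if i \<in> X then Y else X)" for i
    using disj cover by (auto simp: cross_def)
  have YX: "y \<notin> X" if "y \<in> Y" for y using disj that by blast
  have "S \<in> Sym"
  proof (rule SymI)
    fix i j
    have "w i \<bullet> (Q *v w j) = w j \<bullet> (Q *v w i)" by (metis inner_Sym_mult[OF symQ] inner_commute)
    moreover have "cross i j \<longleftrightarrow> cross j i" by (auto simp: cross_def)
    ultimately show "S $ i $ j = S $ j $ i" by (simp add: S_def)
  qed
  moreover have "0 \<le> z \<bullet> (S *v z)" for z
  proof -
    define a where "a = (\<Sum>x\<in>X. (d x * z $ x) *\<^sub>R w x)"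
    define b where "b = (\<Sum>y\<in>Y. (d y * z $ y) *\<^sub>R w y)"
    have Qsum: "Q *v (\<Sum>x\<in>Z. (d x * z $ x) *\<^sub>R w x) = (\<Sum>x\<in>Z. (d x * z $ x) *\<^sub>R A $ x)" for Z
    proof -
      have "Q *v (\<Sum>x\<in>Z. (d x * z $ x) *\<^sub>R w x) = (\<Sum>x\<in>Z. z $ x *\<^sub>R (d x *\<^sub>R (Q *v w x)))"
        by (simp add: linear_sum[OF matrix_vector_mul_linear] matrix_vector_mult_scaleR mult.commute)
      then show ?thesis by (simp add: dw mult.commute)
    qed
    have sq: "(\<Sum>x\<in>Z. d x * (z $ x - A $ x \<bullet> v)\<^sup>2) = (\<Sum>x\<in>Z. d x * (z $ x)\<^sup>2) - v \<bullet> (Q *v v)"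
      if Z: "Z = X \<or> Z = Y" and v: "v = (\<Sum>x\<in>Z. (d x * z $ x) *\<^sub>R w x)" for Z v
    proof -
      have "v \<bullet> (Q *v v) = (\<Sum>x\<in>Z. d x * z $ x * (A $ x \<bullet> v))"
        using Qsum[of Z] unfolding v[symmetric] by (simp add: inner_sum_right inner_commute)
      moreover have "(\<Sum>x\<in>Z. d x * (z $ x - A $ x \<bullet> v)\<^sup>2) = (\<Sum>x\<in>Z. d x * (z $ x)\<^sup>2)
          - 2 * (\<Sum>x\<in>Z. d x * z $ x * (A $ x \<bullet> v)) + (\<Sum>x\<in>Z. d x * (A $ x \<bullet> v)\<^sup>2)"
        by (simp add: power2_diff algebra_simps sum.distrib sum_subtractf sum_distrib_left)
      ultimately show ?thesis using Qq[OF Z, of v] by simp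
    qed
    have ab: "(\<Sum>x\<in>X. \<Sum>y\<in>Y. z $ x * (d x * d y * (w x \<bullet> (Q *v w y)) * z $ y)) = a \<bullet> (Q *v b)"
      by (subst sum.swap) (simp add: a_def b_def linear_sum[OF matrix_vector_mul_linear] matrix_vector_mult_scaleR
          inner_sum_left inner_sum_right sum_distrib_left mult_ac)
    have ba: "(\<Sum>y\<in>Y. \<Sum>x\<in>X. z $ y * (d y * d x * (w y \<bullet> (Q *v w x)) * z $ x)) = b \<bullet> (Q *v a)"
      by (subst sum.swap) (simp add: a_def b_def linear_sum[OF matrix_vector_mul_linear] matrix_vector_mult_scaleR
          inner_sum_left inner_sum_right sum_distrib_left mult_ac)
    have "z \<bullet> (S *v z) = (\<Sum>i\<in>UNIV. z $ i * (\<Sum>j\<in>UNIV. S $ i $ j * z $ j))"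
      by (simp add: inner_vec_def matrix_vector_mult_def)
    also have "\<dots> = (\<Sum>i\<in>UNIV. d i * (z $ i)\<^sup>2 -
        (\<Sum>j\<in>{j. cross i j}. z $ i * (d i * d j * (w i \<bullet> (Q *v w j)) * z $ j)))"
      unfolding S_mult by (simp add: right_diff_distrib sum_distrib_left power2_eq_square mult_ac)
    also have "\<dots> = (\<Sum>x\<in>X. d x * (z $ x)\<^sup>2) + (\<Sum>y\<in>Y. d y * (z $ y)\<^sup>2) - a \<bullet> (Q *v b) - b \<bullet> (Q *v a)"
      unfolding ab[symmetric] ba[symmetric] sum_bipartition sum_subtractf
      by (simp add: crossSet YX cong: sum.cong)
    \<comment> \<open>Completing the square on each side leaves the forms of \<open>Q\<close> at
      \<open>a\<close> and \<open>b\<close>, which combine with the cross terms into its form at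
      \<open>a - b\<close>.\<close>
    also have "\<dots> = (\<Sum>x\<in>X. d x * (z $ x - A $ x \<bullet> a)\<^sup>2) + (\<Sum>y\<in>Y. d y * (z $ y - A $ y \<bullet> b)\<^sup>2)
        + (a - b) \<bullet> (Q *v (a - b))"
      using sq[of X a] sq[of Y b]
      by (simp add: a_def[symmetric] b_def[symmetric] matrix_vector_mult_diff_distrib
          inner_diff_left inner_diff_right)
    also have "\<dots> \<ge> 0"
      using d(1) Qq[of X "a - b"] by (intro add_nonneg_nonneg sum_nonneg) (auto intro!: sum_nonneg)
    finally show ?thesis .
  qed
  moreover have "S $ i0 $ i0 \<noteq> 0" using d by (simp add: S_def)
  moreover have "supported_on (complete_bipartite X Y) S"
    unfolding supported_on_def complete_bipartite_edge_iff by (auto simp: S_def cross_def)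
  moreover have "S ** A = 0"
  proof (simp add: vec_eq_iff, intro allI)
    fix i l
    \<comment> \<open>The sum runs over the side opposite to \<open>i\<close>; the balance condition
      makes it \<open>Q\<close> for either side.\<close>
    have Qw: "(\<Sum>j | cross i j. d j * (A $ j \<bullet> w i) * A $ j $ l) = (Q *v w i) $ l"
    proof (cases "i \<in> X")
      case True
      then show ?thesis unfolding QY by (simp add: crossSet)
    next
      case False
      then show ?thesis unfolding QX by (simp add: crossSet)
    qed
    have "(S ** A) $ i $ l = d i * A $ i $ l - (\<Sum>j | cross i j. d i * d j * (w i \<bullet> (Q *v w j)) * A $ j $ l)"
      by (simp add: matrix_matrix_mult_def S_mult)
    also have "(\<Sum>j | cross i j. d i * d j * (w i \<bullet> (Q *v w j)) * A $ j $ l)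
        = d i * (\<Sum>j | cross i j. (w i \<bullet> (d j *\<^sub>R (Q *v w j))) * A $ j $ l)"
      by (simp add: sum_distrib_left mult_ac)
    also have "\<dots> = d i * (\<Sum>j | cross i j. d j * (A $ j \<bullet> w i) * A $ j $ l)"
      by (simp add: dw inner_commute)
    also have "\<dots> = (d i *\<^sub>R (Q *v w i)) $ l" by (simp add: Qw)
    also have "\<dots> = d i * A $ i $ l" by (simp add: dw)
    finally show "(S ** A) $ i $ l = 0" by simp
  qed
  ultimately show ?thesis unfolding pos_semidef_def by (intro exI[of _ S]) auto
qed

end

subsection \<open>Zariski density of the matrices without completion\<close>

text \<open>Gram-Schmidt depends continuously on a parameter where the family is independent.\<close>

lemma continuous_orthogonal_projection:
  fixes g :: "'j \<Rightarrow> 'p::t2_space \<Rightarrow> 'a::euclidean_space"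
  assumes "finite J" "\<And>j. j \<in> J \<Longrightarrow> isCont (g j) p"
    and "\<And>j. j \<in> J \<Longrightarrow> g j p \<notin> span ((\<lambda>i. g i p) ` (J - {j}))"
    and "isCont b p"
  shows "\<exists>c. isCont c p \<and> (\<forall>t. b t - c t \<in> span ((\<lambda>i. g i t) ` J) \<and> (\<forall>j\<in>J. c t \<bullet> g j t = 0))"
  using assms
proof (induction J arbitrary: b rule: finite_induct)
  case empty
  then show ?case by (intro exI[of _ b]) (simp add: span_zero)
next
  case (insert j J)
  let ?s = "\<lambda>J t. span ((\<lambda>i. g i t) ` J)"
  have ind: "g i p \<notin> ?s (J - {i}) p" if "i \<in> J" for i
  proof -
    have "?s (J - {i}) p \<subseteq> ?s (insert j J - {i}) p" by (intro span_mono) auto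
    then show ?thesis using insert.prems(2)[of i] that by blast
  qed
  have IH: "\<exists>c. isCont c p \<and> (\<forall>t. b t - c t \<in> ?s J t \<and> (\<forall>j\<in>J. c t \<bullet> g j t = 0))"
    if "isCont b p" for b
    using insert.IH[OF insert.prems(1) ind that] by blast
  obtain h where h: "isCont h p" "\<And>t. g j t - h t \<in> ?s J t" "\<And>t i. i \<in> J \<Longrightarrow> h t \<bullet> g i t = 0"
    using IH[of "g j"] insert.prems(1) by blast
  obtain c where c: "isCont c p" "\<And>t. b t - c t \<in> ?s J t" "\<And>t i. i \<in> J \<Longrightarrow> c t \<bullet> g i t = 0"
    using IH[OF insert.prems(3)] by blast
  have "g j p \<notin> ?s J p" using insert.prems(2)[of j] insert.hyps(2) by simp
  then have hp: "h p \<noteq> 0" using h(2)[of p] by auto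
  \<comment> \<open>Independence gives \<open>h p \<noteq> 0\<close>, hence continuity at
    \<open>p\<close>. Where \<open>h t = 0\<close> the quotient is 0 by convention and
    \<open>e t = c t\<close> still has the required properties.\<close>
  define e where "e t = c t - (c t \<bullet> h t / (h t \<bullet> h t)) *\<^sub>R h t" for t
  have "c t \<bullet> (g j t - h t) = 0" "h t \<bullet> (g j t - h t) = 0" for t
    by (rule orthogonal_to_span[OF h(2), unfolded orthogonal_def]; use c(3) h(3) in auto)+
  then have cg: "c t \<bullet> g j t = c t \<bullet> h t" and hg: "h t \<bullet> g j t = h t \<bullet> h t" for t
    by (simp_all add: inner_diff_right)
  show ?case
  proof (intro exI[of _ e] conjI allI ballI)
    show "isCont e p" unfolding e_def using h(1) c(1) hp by (intro continuous_intros) auto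
    fix t
    have sub: "?s J t \<subseteq> ?s (insert j J) t" by (intro span_mono) auto
    have "g j t \<in> ?s (insert j J) t" by (intro span_base) auto
    moreover have "g j t - h t \<in> ?s (insert j J) t" using h(2) sub by blast
    ultimately have "g j t - (g j t - h t) \<in> ?s (insert j J) t" by (rule span_diff)
    then have "h t \<in> ?s (insert j J) t" by simp
    then have "(b t - c t) + (c t \<bullet> h t / (h t \<bullet> h t)) *\<^sub>R h t \<in> ?s (insert j J) t"
      using c(2) sub by (intro span_add span_scale) auto
    then show "b t - e t \<in> ?s (insert j J) t" by (simp add: e_def algebra_simps)
    fix i assume "i \<in> insert j J"
    then show "e t \<bullet> g i t = 0"
      using c(3) h(3) cg hg by (cases "h t = 0") (auto simp: e_def inner_diff_left)
  qed
qed

text \<open>Project the constant \<open>c0\<close> away from the moving span; at \<open>p\<close> it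
  is already orthogonal and stays fixed. This carries a relation at one configuration to nearby
  ones.\<close>

lemma continuous_orthogonal_extension:
  fixes g :: "'j \<Rightarrow> 'p::t2_space \<Rightarrow> 'a::euclidean_space"
  assumes "finite J" "\<And>j. j \<in> J \<Longrightarrow> isCont (g j) p"
    and "\<And>j. j \<in> J \<Longrightarrow> g j p \<notin> span ((\<lambda>i. g i p) ` (J - {j}))"
    and orth: "\<And>j. j \<in> J \<Longrightarrow> c0 \<bullet> g j p = 0"
  obtains c where "isCont c p" "c p = c0" "\<And>t j. j \<in> J \<Longrightarrow> c t \<bullet> g j t = 0"
proof -
  obtain c where c: "isCont c p" "\<And>t. c0 - c t \<in> span ((\<lambda>i. g i t) ` J)"
    "\<And>t j. j \<in> J \<Longrightarrow> c t \<bullet> g j t = 0"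
    using continuous_orthogonal_projection[OF assms(1-3), of "\<lambda>_. c0"] by auto
  have "(c0 - c p) \<bullet> (c0 - c p) = 0"
    by (rule orthogonal_to_span[OF c(2), unfolded orthogonal_def])
      (use orth c(3) in \<open>auto simp: inner_diff_left\<close>)
  then have "c p = c0" by simp
  then show ?thesis using that c by blast
qed

text \<open>With \<open>P\<close> the orthogonal projection onto the range of \<open>A\<close>, the matrix \<open>s P + A\<close> is positive
  semidefinite for large \<open>s\<close>; then continue polynomially to \<open>s = 0\<close>.\<close>

lemma polynomial_vanishing_on_psd:
  fixes f :: "real^'n^'n \<Rightarrow> real"
  assumes f: "real_polynomial_function f"
    and psd: "\<And>B. pos_semidef B \<Longrightarrow> rank B \<le> r \<Longrightarrow> f B = 0"
    and A: "A \<in> rank_variety r"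
  shows "f A = 0"
proof -
  have sym: "A \<in> Sym" and rk: "rank A \<le> r" using A by (auto simp: rank_variety_def)
  obtain P where P: "P \<in> Sym" "\<And>x. P *v x \<in> range ((*v) A)"
    "\<And>x. x \<in> range ((*v) A) \<Longrightarrow> P *v x = x"
    by (rule orthogonal_projection_matrix[of "range ((*v) A)"])
      (auto intro: linear_subspace_image)
  define C where "C = onorm ((*v) A)"
  \<comment> \<open>Since \<open>A = P A P\<close>, the form depends on \<open>P *v x\<close> only,
    and there \<open>s\<close> times the identity dominates once \<open>s\<close> reaches the
    operator norm.\<close>
  have AP: "x \<bullet> (A *v x) = (P *v x) \<bullet> (A *v (P *v x))" for x
  proof -
    have "(P *v x) \<bullet> (A *v z) = x \<bullet> (A *v z)" for z
      using inner_Sym_mult[OF P(1), of x "A *v z"] P(3)[of "A *v z"] by simp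
    then have "(P *v x) \<bullet> (A *v (P *v x)) = x \<bullet> (A *v (P *v x))" by simp
    also have "\<dots> = (P *v x) \<bullet> (A *v x)" by (metis inner_Sym_mult[OF sym] inner_commute)
    also have "\<dots> = x \<bullet> (A *v x)" by fact
    finally show ?thesis by simp
  qed
  have PP: "x \<bullet> (P *v x) = (P *v x) \<bullet> (P *v x)" for x
    using inner_Sym_mult[OF P(1), of x "P *v x"] P(3)[OF P(2)] by simp
  have van: "f (s *\<^sub>R P + A) = 0" if s: "s \<ge> C" for s
  proof (rule psd)
    show "pos_semidef (s *\<^sub>R P + A)"
      unfolding pos_semidef_def
    proof (intro conjI allI)
      show "s *\<^sub>R P + A \<in> Sym"
        by (rule SymI) (simp add: Sym_swap[OF sym] Sym_swap[OF P(1)])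
      fix x
      let ?y = "P *v x"
      have "\<bar>?y \<bullet> (A *v ?y)\<bar> \<le> norm ?y * norm (A *v ?y)" by (rule Cauchy_Schwarz_ineq2)
      also have "\<dots> \<le> norm ?y * (C * norm ?y)"
        unfolding C_def by (intro mult_left_mono onorm) auto
      also have "\<dots> \<le> norm ?y * (s * norm ?y)" using s by (intro mult_left_mono mult_right_mono) auto
      also have "\<dots> = s * (?y \<bullet> ?y)" by (simp add: dot_square_norm power2_eq_square)
      finally show "0 \<le> x \<bullet> ((s *\<^sub>R P + A) *v x)"
        by (simp add: matrix_vector_mult_add_rdistrib scaleR_matrix_vector_assoc[symmetric]
            inner_add_right AP[of x] PP)
    qed
    have "rank (s *\<^sub>R P + A) \<le> dim (range ((*v) A))"
    proof (rule rank_le_dim)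
      fix x
      show "(s *\<^sub>R P + A) *v x \<in> range ((*v) A)"
        using P(2) unfolding matrix_vector_mult_add_rdistrib scaleR_matrix_vector_assoc[symmetric]
        by (intro subspace_add subspace_scale) (auto intro: linear_subspace_image)
    qed
    then show "rank (s *\<^sub>R P + A) \<le> r" using rk by (simp add: rank_dim_range)
  qed
  have "real_polynomial_function (f \<circ> (\<lambda>s. s *\<^sub>R P + A))"
    using f by (intro real_polynomial_function_compose polynomial_function_matrix)
      (auto intro!: real_polynomial_function_sum
        real_polynomial_function.intros(2-4) real_polynomial_function.intros(1)[OF bounded_linear_ident])
  moreover have "infinite {s. (f \<circ> (\<lambda>s. s *\<^sub>R P + A)) s = 0}"
  proof (rule infinite_super)
    show "{C..} \<subseteq> {s. (f \<circ> (\<lambda>s. s *\<^sub>R P + A)) s = 0}" using van by auto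
    show "infinite {C..}" by (rule infinite_Ici)
  qed
  ultimately have "(f \<circ> (\<lambda>s. s *\<^sub>R P + A)) 0 = 0" by (rule real_polynomial_function_eq_0)
  then show ?thesis by simp
qed

text \<open>On the segment from \<open>u0\<close> to \<open>u\<close> the value of \<open>f\<close>
  is a polynomial in \<open>t\<close> with infinitely many zeros near 0, so it also vanishes at
  \<open>t = 1\<close>.\<close>

lemma polynomial_vanishing_near_gram:
  fixes f :: "real^'n^'n \<Rightarrow> real" and u0 :: "nat \<Rightarrow> real^'n"
  assumes f: "real_polynomial_function f"
    and van: "\<And>u. \<forall>\<^sub>F t in at_right (0::real). f (\<Sum>k<r. outer (u0 k + t *\<^sub>R u k)) = 0"
  shows "f (\<Sum>k<r. outer (u k)) = 0"
proof -
  define M where "M t = (\<Sum>k<r. outer (u0 k + t *\<^sub>R (u k - u0 k)))" for t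
  have "real_polynomial_function (\<lambda>t. M t $ i $ j)" for i j
    unfolding M_def by (auto simp: outer_def intro!: real_polynomial_function_sum
        real_polynomial_function.intros(2-4) real_polynomial_function.intros(1)[OF bounded_linear_ident])
  then have poly: "real_polynomial_function (f \<circ> M)"
    using f by (intro real_polynomial_function_compose polynomial_function_matrix)
  obtain b where b: "b > 0" "\<And>t. 0 < t \<Longrightarrow> t < b \<Longrightarrow> f (M t) = 0"
    using van[of "\<lambda>k. u k - u0 k"] unfolding eventually_at_right_field M_def by auto
  have "infinite {t. (f \<circ> M) t = 0}"
  proof (rule infinite_super)
    show "{0<..<b} \<subseteq> {t. (f \<circ> M) t = 0}" using b by auto
    show "infinite {0<..<b}" using b by (simp add: infinite_Ioo)
  qed
  then have "(f \<circ> M) 1 = 0" using poly by (intro real_polynomial_function_eq_0)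
  then show ?thesis by (simp add: M_def)
qed

section \<open>Configurations with a signed balance relation\<close>

text \<open>After \<open>2 * r\<close> vertices are spent, more than \<open>Suc r choose 2\<close>
  vertices in total leave at least one for each pair \<open>0 < a < b < r\<close>.\<close>

lemma card_strict_pairs:
  "card (SIGMA b:{..<r}. {0<..<b}) + 2 * r = (Suc r choose 2) + 1" if "0 < r" for r :: nat
proof -
  have "card (SIGMA b:{..<r}. {0<..<b}) = (\<Sum>b<r. b - 1)" by simp
  moreover have "(\<Sum>b<r. b - 1) + 2 * r = (Suc r choose 2) + 1"
    using that
  proof (induction r rule: nat_induct_non_zero)
    case (Suc r)
    then show ?case by (simp add: numeral_2_eq_2)
  qed (simp add: numeral_2_eq_2)
  ultimately show ?thesis by simp
qed

text \<open>Vertices are assigned vectors \<open>v i \<in> \<real>\<^sup>r\<close>: the unit vectors go to \<open>X\<close>; the all-ones vector and,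
  for \<open>0 < b < r\<close>, the vectors \<open>p\<^sup>-\<^sup>1 e\<^sub>0 - p e\<^sub>b\<close> go to \<open>Y\<close>; each remaining pair \<open>0 < a < b < r\<close>
  gets \<open>e\<^sub>a + e\<^sub>b\<close> on the side \<open>X\<close> or \<open>e\<^sub>a - e\<^sub>b\<close> on the side \<open>Y\<close>, and all further vertices get 0.
  The off-diagonal part of \<open>\<Sum>i. c i v i v i\<^sup>T\<close> then cancels against that of the all-ones vector
  with \<open>c = -1\<close> on \<open>X\<close> and \<open>c = 1\<close> on \<open>Y\<close>. For large \<open>p\<close> the remaining diagonal is positive, so
  that negative weights of the unit vectors cancel it.\<close>

lemma signed_configuration:
  fixes X Y :: "'v::finite set"
  assumes disj: "X \<inter> Y = {}" and rX: "r \<le> card X" and rY: "r \<le> card Y"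
    and count: "Suc r choose 2 < card X + card Y"
  obtains v :: "'v \<Rightarrow> nat \<Rightarrow> real" and c :: "'v \<Rightarrow> real" and xs :: "nat \<Rightarrow> 'v"
    and pt :: "nat \<times> nat \<Rightarrow> 'v"
  where "\<And>i. i \<in> X \<Longrightarrow> c i < 0" "\<And>i. i \<in> Y \<Longrightarrow> 0 < c i"
    and "\<And>k l. k < r \<Longrightarrow> l < r \<Longrightarrow> (\<Sum>i\<in>UNIV. c i * (v i k * v i l)) = 0"
    and "inj_on xs {..<r}" "\<And>a k. a < r \<Longrightarrow> k < r \<Longrightarrow> v (xs a) k = (if k = a then 1 else 0)"
    and "\<And>b a. a < b \<Longrightarrow> b < r \<Longrightarrow> v (pt (b, a)) a * v (pt (b, a)) b \<noteq> 0"
    and "\<And>b a k. a < b \<Longrightarrow> b < r \<Longrightarrow> k \<noteq> a \<Longrightarrow> k \<noteq> b \<Longrightarrow> v (pt (b, a)) k = 0"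
proof (cases "r = 0")
  case True
  show ?thesis
    by (rule that[of "\<lambda>i. if i \<in> X then -1 else 1" "\<lambda>_ _. 0"]) (use disj True in auto)
next
  case False
  obtain xs where xs: "xs ` {..<r} \<subseteq> X" "inj_on xs {..<r}"
    using card_le_inj[of "{..<r}" X] rX by auto
  obtain ys where ys: "ys ` {..<r} \<subseteq> Y" "inj_on ys {..<r}"
    using card_le_inj[of "{..<r}" Y] rY by auto
  define T where "T = (SIGMA b:{..<r}. {0<..<b})"
  define R where "R = X \<union> Y - (xs ` {..<r} \<union> ys ` {..<r})"
  have "card T \<le> card R"
  proof -
    have "card (xs ` {..<r} \<union> ys ` {..<r}) = 2 * r"
      using xs ys disj by (subst card_Un_disjoint) (auto simp: card_image)
    moreover have "card (X \<union> Y) = card X + card Y" using disj by (simp add: card_Un_disjoint)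
    ultimately have "card R = card X + card Y - 2 * r"
      unfolding R_def using xs(1) ys(1) by (subst card_Diff_subset) auto
    then show ?thesis using card_strict_pairs[of r] False count unfolding T_def by linarith
  qed
  then obtain qs where qs: "qs ` T \<subseteq> R" "inj_on qs T"
    using card_le_inj[of T R] unfolding T_def by auto
  define PS where "PS = (SIGMA b:{..<r}. {..<b})"
  have finPS: "finite PS" by (simp add: PS_def)
  have T_PS: "(b, a) \<in> T" if "(b, a) \<in> PS" "a \<noteq> 0" for a b using that by (auto simp: PS_def T_def)
  define pt where "pt = (\<lambda>(b, a). if a = 0 then ys b else qs (b, a))"
  have pt0: "pt (b, 0) = ys b" for b by (simp add: pt_def)
  have ptR: "pt (b, a) \<in> R" if "(b, a) \<in> PS" "a \<noteq> 0" for a b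
    using qs(1) T_PS[OF that] that by (auto simp: pt_def)
  have ptY: "pt (b, 0) \<in> Y" if "(b, 0) \<in> PS" for b
    using ys(1) that by (auto simp: pt0 PS_def)
  have ysR: "ys b \<notin> R" if "b < r" for b using that by (auto simp: R_def)
  have inj_pt: "inj_on pt PS"
  proof (rule inj_onI)
    fix p q assume pq: "p \<in> PS" "q \<in> PS" "pt p = pt q"
    obtain b a b' a' where p: "p = (b, a)" and q: "q = (b', a')" by (metis surj_pair)
    have lt: "b < r" "b' < r" using pq by (auto simp: PS_def p q)
    show "p = q"
    proof (cases "a = 0"; cases "a' = 0")
      assume "a = 0" "a' = 0"
      then show ?thesis using pq(3) lt ys(2) by (auto simp: p q pt0 inj_on_def)
    next
      assume "a = 0" "a' \<noteq> 0"
      then show ?thesis using pq ptR[of b' a'] ysR[OF lt(1)] by (simp add: p q pt0)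
    next
      assume "a \<noteq> 0" "a' = 0"
      then show ?thesis using pq ptR[of b a] ysR[OF lt(2)] by (simp add: p q pt0)
    next
      assume a: "a \<noteq> 0" "a' \<noteq> 0"
      then have "qs (b, a) = qs (b', a')" using pq(3) by (simp add: p q pt_def)
      then show ?thesis using qs(2) a T_PS pq(1,2) unfolding p q inj_on_def by blast
    qed
  qed
  have y0: "ys 0 \<in> Y" using ys(1) False by auto
  have y0_xs: "ys 0 \<notin> xs ` {..<r}" using y0 xs(1) disj by auto
  have pt_y0: "pt q \<noteq> ys 0" if "q \<in> PS" for q
  proof -
    obtain b a where q: "q = (b, a)" by (metis surj_pair)
    show ?thesis
    proof (cases "a = 0")
      case True
      then have "0 < b" "b < r" using that by (auto simp: PS_def q)
      then show ?thesis using True inj_onD[OF ys(2), of b 0] by (auto simp: q pt0)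
    next
      case a: False
      then show ?thesis using ptR[of b a] that ysR[of 0] False by (auto simp: q)
    qed
  qed
  then have y0_pt: "ys 0 \<notin> pt ` PS" by force
  have pt_xs: "pt q \<notin> xs ` {..<r}" if "q \<in> PS" for q
  proof -
    obtain b a where q: "q = (b, a)" by (metis surj_pair)
    show ?thesis
      using that ptR[of b a] ptY[of b] xs(1) disj by (cases "a = 0") (auto simp: q R_def)
  qed
  then have xs_pt: "xs ` {..<r} \<inter> pt ` PS = {}" by force
  \<comment> \<open>Larger than the number of pairs, so that \<open>p^2\<close> outweighs all other
    diagonal contributions, each at most 1.\<close>
  define p where "p = real (card PS) + 1"
  have p: "p \<ge> 1" by (simp add: p_def)
  define sg :: "nat \<times> nat \<Rightarrow> real" where "sg q = (if pt q \<in> X then 1 else -1)" for q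
  define lo where "lo = (\<lambda>(b::nat, a::nat). if a = 0 then 1 / p else 1)"
  define hi where "hi = (\<lambda>(b, a). (if a = 0 then p else 1) * sg (b, a))"
  define pv where "pv q k = (if k = snd q then lo q else if k = fst q then hi q else 0)" for q k
  have lohi: "lo q * hi q = sg q" for q using p by (cases q) (auto simp: lo_def hi_def)
  define v where "v i k = (if i \<in> xs ` {..<r} then (if k = inv_into {..<r} xs i then 1 else 0)
      else if i = ys 0 then 1 else if i \<in> pt ` PS then pv (inv_into PS pt i) k else 0)" for i k
  have v_xs: "v (xs a) k = (if k = a then 1 else 0)" if "a < r" for a k
    using that xs(2) by (simp add: v_def inv_into_f_f)
  have v_y0: "v (ys 0) k = 1" for k using y0_xs by (simp add: v_def)
  have v_pt: "v (pt q) k = pv q k" if "q \<in> PS" for q k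
    using pt_xs[OF that] pt_y0[OF that] that inj_pt by (simp add: v_def inv_into_f_f)
  have v_0: "v i k = 0" if "i \<notin> xs ` {..<r}" "i \<noteq> ys 0" "i \<notin> pt ` PS" for i k
    using that by (simp add: v_def)
  \<comment> \<open>The diagonal entry of the relation before the unit vectors enter; the weight
    \<open>- D a\<close> of the unit vector cancels it.\<close>
  define D where "D a = 1 - (\<Sum>q\<in>PS. sg q * (pv q a)\<^sup>2)" for a
  have term_0: "sg q * (pv q a)\<^sup>2 \<le> 0" if "q \<in> PS" "snd q = 0" for q a
  proof -
    have q: "q = (fst q, 0)" using that(2) by (simp add: prod_eq_iff)
    then have "pt q \<in> Y" using ptY[of "fst q"] that(1) by simp
    then have "sg q = -1" using disj by (auto simp: sg_def)
    then show ?thesis by simp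
  qed
  have term_1: "sg q * (pv q a)\<^sup>2 \<le> 1" if "q \<in> PS" for q a
  proof (cases "snd q = 0")
    case True
    then show ?thesis using term_0[OF that, of a] by simp
  next
    case False
    then have "(pv q a)\<^sup>2 \<le> 1" by (cases q) (auto simp: pv_def lo_def hi_def sg_def)
    then show ?thesis by (auto simp: sg_def intro: order_trans[of _ 0])
  qed
  have D_pos: "D a > 0" if a: "a < r" for a
  proof (cases "a = 0")
    case True
    have "(\<Sum>q\<in>PS. sg q * (pv q a)\<^sup>2) \<le> 0"
    proof (rule sum_nonpos)
      fix q assume q: "q \<in> PS"
      show "sg q * (pv q a)\<^sup>2 \<le> 0"
      proof (cases "snd q = 0")
        case False
        moreover have "fst q \<noteq> 0" using q by (auto simp: PS_def)
        ultimately have "pv q a = 0" using True by (simp add: pv_def)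
        then show ?thesis by simp
      qed (use term_0[OF q] in auto)
    qed
    then show ?thesis by (simp add: D_def)
  next
    case False
    let ?q = "(a, 0::nat)"
    have q: "?q \<in> PS" using False a by (auto simp: PS_def)
    have sq: "sg ?q = -1" using ptY[OF q] disj by (auto simp: sg_def)
    have "(\<Sum>q\<in>PS. sg q * (pv q a)\<^sup>2) = sg ?q * (pv ?q a)\<^sup>2 + (\<Sum>q\<in>PS - {?q}. sg q * (pv q a)\<^sup>2)"
      using q finPS by (simp add: sum.remove)
    also have "sg ?q * (pv ?q a)\<^sup>2 = - p\<^sup>2" using False by (simp add: pv_def hi_def sq)
    also have "(\<Sum>q\<in>PS - {?q}. sg q * (pv q a)\<^sup>2) \<le> (\<Sum>q\<in>PS - {?q}. 1)"
      by (intro sum_mono term_1) auto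
    also have "\<dots> \<le> real (card PS)" using finPS by (simp add: card_mono)
    finally have "(\<Sum>q\<in>PS. sg q * (pv q a)\<^sup>2) \<le> p - 1 - p\<^sup>2" by (simp add: p_def)
    moreover have "p \<le> p\<^sup>2" using p by (simp add: power2_eq_square)
    ultimately show ?thesis by (simp add: D_def)
  qed
  define c where "c i = (if i \<in> xs ` {..<r} then - D (inv_into {..<r} xs i)
      else if i \<in> X then -1 else 1)" for i
  have c_xs: "c (xs a) = - D a" if "a < r" for a using that xs(2) by (simp add: c_def inv_into_f_f)
  show ?thesis
  proof (rule that[of c v xs pt])
    show "c i < 0" if "i \<in> X" for i
      using that D_pos c_xs by (cases "i \<in> xs ` {..<r}") (auto simp: c_def)
    show "0 < c i" if "i \<in> Y" for i
    proof -
      have "i \<notin> X" "i \<notin> xs ` {..<r}" using that disj xs(1) by auto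
      then show ?thesis by (simp add: c_def)
    qed
    show "inj_on xs {..<r}" by fact
    show "v (xs a) k = (if k = a then 1 else 0)" if "a < r" for a k by (rule v_xs[OF that])
    show "v (pt (b, a)) a * v (pt (b, a)) b \<noteq> 0" if "a < b" "b < r" for a b
    proof -
      have "(b, a) \<in> PS" using that by (auto simp: PS_def)
      then show ?thesis using that lohi[of "(b, a)"] by (auto simp: v_pt pv_def sg_def split: if_splits)
    qed
    show "v (pt (b, a)) k = 0" if "a < b" "b < r" "k \<noteq> a" "k \<noteq> b" for a b k
    proof -
      have "(b, a) \<in> PS" using that by (auto simp: PS_def)
      then show ?thesis using that by (simp add: v_pt pv_def)
    qed
    have off: "(\<Sum>i\<in>UNIV. c i * (v i k * v i l)) = 0" if kl: "l \<le> k" "k < r" for k l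
    proof -
      let ?F = "\<lambda>i. c i * (v i k * v i l)"
      have "(\<Sum>i\<in>UNIV. ?F i) = (\<Sum>i\<in>insert (ys 0) (xs ` {..<r} \<union> pt ` PS). ?F i)"
        by (rule sum.mono_neutral_right) (auto simp: v_0)
      also have "\<dots> = ?F (ys 0) + (\<Sum>i\<in>xs ` {..<r} \<union> pt ` PS. ?F i)"
        using y0_xs y0_pt finPS by (subst sum.insert) auto
      also have "(\<Sum>i\<in>xs ` {..<r} \<union> pt ` PS. ?F i) = (\<Sum>a<r. ?F (xs a)) + (\<Sum>q\<in>PS. ?F (pt q))"
        using xs_pt finPS by (subst sum.union_disjoint) (simp_all add: sum.reindex xs(2) inj_pt)
      also have "?F (ys 0) = 1" using y0 y0_xs disj by (auto simp: v_y0 c_def)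
      also have "(\<Sum>a<r. ?F (xs a)) = (\<Sum>a<r. if a = k then (if l = k then - D k else 0) else 0)"
        by (intro sum.cong) (auto simp: v_xs c_xs)
      also have "\<dots> = (if l = k then - D k else 0)" using kl by simp
      also have "(\<Sum>q\<in>PS. ?F (pt q)) = - (\<Sum>q\<in>PS. sg q * (pv q k * pv q l))"
        using pt_xs by (auto simp: c_def v_pt sg_def sum_negf[symmetric] intro!: sum.cong)
      finally have eq: "(\<Sum>i\<in>UNIV. ?F i) = 1 + ((if l = k then - D k else 0) -
        (\<Sum>q\<in>PS. sg q * (pv q k * pv q l)))" by simp
      show ?thesis
      proof (cases "l = k")
        case True
        then show ?thesis using eq by (simp add: D_def power2_eq_square)
      next
        case False
        \<comment> \<open>Only the pair \<open>(k, l)\<close> has both coordinates nonzero, and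
          there \<open>lo * hi * sg = sg^2 = 1\<close>, which cancels the all-ones vector.\<close>
        have "(\<Sum>q\<in>PS. sg q * (pv q k * pv q l)) = (\<Sum>q\<in>PS. if q = (k, l) then 1 else 0)"
        proof (rule sum.cong)
          fix q assume q: "q \<in> PS"
          obtain b a where ba: "q = (b, a)" by (metis surj_pair)
          have "a < b" using q by (auto simp: PS_def ba)
          then show "sg q * (pv q k * pv q l) = (if q = (k, l) then 1 else 0)"
            using False kl lohi[of q] by (auto simp: pv_def ba mult.commute) (auto simp: sg_def)
        qed simp
        also have "\<dots> = 1" using False kl finPS by (auto simp: PS_def)
        finally show ?thesis using eq False by simp
      qed
    qed
    show "(\<Sum>i\<in>UNIV. c i * (v i k * v i l)) = 0" if "k < r" "l < r" for k l
      using off[of l k] off[of k l] that by (cases "l \<le> k") (simp_all add: mult.commute mult.left_commute)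
  qed
qed

section \<open>Perturbing the configuration\<close>

lemma isCont_real_polynomial_function:
  fixes f :: "real \<Rightarrow> real"
  shows "real_polynomial_function f \<Longrightarrow> isCont f t"
  using differentiable_at_real_polynomial_function[of f t UNIV] differentiable_imp_continuous_within
  by blast

text \<open>The matrix sends the unit vector at \<open>xs a\<close> to \<open>u a\<close>, and the
  \<open>u a\<close> are independent already in the coordinates \<open>xs\<close>.\<close>

lemma rank_sum_outer_eq:
  fixes u :: "nat \<Rightarrow> real^'n"
  assumes inj: "inj_on xs {..<r}"
    and u: "\<And>a k. a < r \<Longrightarrow> k < r \<Longrightarrow> u k $ xs a = (if k = a then 1 else 0)"
  shows "rank (\<Sum>k<r. outer (u k)) = r"
proof (rule antisym)
  define A where "A = (\<Sum>k<r. outer (u k))"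
  define \<pi> :: "real^'n \<Rightarrow> real^'n" where "\<pi> x = (\<chi> i. if i \<in> xs ` {..<r} then x $ i else 0)" for x
  have lin: "linear \<pi>" by (rule linearI) (auto simp: \<pi>_def vec_eq_iff)
  show "rank (\<Sum>k<r. outer (u k)) \<le> r" using rank_sum_outer_le[of "{..<r}" u] by simp
  have uA: "u a \<in> range ((*v) A)" if "a < r" for a
  proof -
    have "A *v axis (xs a) 1 = (\<Sum>k<r. if k = a then u a else 0)"
      unfolding A_def matrix_vector_mult_sum_left outer_mult_vec
      using that by (intro sum.cong) (auto simp: inner_axis u)
    then have "u a = A *v axis (xs a) 1" using that by simp
    then show ?thesis by blast
  qed
  have pu: "\<pi> (u a) = axis (xs a) 1" if "a < r" for a
    using that inj by (auto simp: \<pi>_def vec_eq_iff u axis_def inj_on_def)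
  define B where "B = (\<lambda>a. axis (xs a) (1::real)) ` {..<r}"
  have "inj_on (\<lambda>a. axis (xs a) (1::real)) {..<r}"
    using inj by (auto simp: inj_on_def axis_eq_axis)
  then have "card B = r" by (simp add: B_def card_image)
  moreover have "independent B"
    by (rule independent_mono[OF independent_Basis]) (auto simp: B_def Basis_vec_def)
  ultimately have "r = dim B" by (simp add: dim_eq_card_independent)
  also have "\<dots> \<le> dim (\<pi> ` range ((*v) A))"
    by (rule dim_subset) (force simp: B_def pu[symmetric] intro: uA)
  also have "\<dots> \<le> rank A" unfolding rank_dim_range by (rule dim_image_le[OF lin])
  finally show "r \<le> rank (\<Sum>k<r. outer (u k))" by (simp add: A_def)
qed

text \<open>Small perturbations of the configuration in any direction give matrices without
  completion. A polynomial vanishing there vanishes on all sums of \<open>r\<close> outer products,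
  then on the whole rank variety, so the exceptional set cannot lie in a proper algebraic
  subset.\<close>

lemma not_almost_all_completable:
  fixes X Y :: "'v::finite set"
  assumes disj: "X \<inter> Y = {}" and cover: "X \<union> Y = UNIV"
    and r: "r \<le> card X" "r \<le> card Y" "Suc r choose 2 < card X + card Y"
  shows "\<not> almost_all_psd_rank r (\<lambda>A::real^'v^'v.
    \<exists>P. pos_def P \<and> graph_proj (complete_bipartite X Y) A = graph_proj (complete_bipartite X Y) P)"
    (is "\<not> almost_all_psd_rank r ?Q")
proof
  assume "almost_all_psd_rank r ?Q"
  then obtain F where F: "\<And>f. f \<in> F \<Longrightarrow> real_polynomial_function f"
    and proper: "{A. \<forall>f\<in>F. f A = 0} \<subset> rank_variety r"
    and bad: "{A. pos_semidef A \<and> rank A = r \<and> \<not> ?Q A} \<subseteq> {A. \<forall>f\<in>F. f A = 0}"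
    unfolding almost_all_psd_rank_def algebraic_set_def by auto
  obtain v :: "'v \<Rightarrow> nat \<Rightarrow> real" and c0 :: "'v \<Rightarrow> real" and xs pt
    where cX: "\<And>i. i \<in> X \<Longrightarrow> c0 i < 0" and cY: "\<And>i. i \<in> Y \<Longrightarrow> 0 < c0 i"
    and bal0: "\<And>k l. k < r \<Longrightarrow> l < r \<Longrightarrow> (\<Sum>i\<in>UNIV. c0 i * (v i k * v i l)) = 0"
    and inj: "inj_on xs {..<r}"
    and v_xs: "\<And>a k. a < r \<Longrightarrow> k < r \<Longrightarrow> v (xs a) k = (if k = a then 1 else 0)"
    and v_pt: "\<And>b a. a < b \<Longrightarrow> b < r \<Longrightarrow> v (pt (b, a)) a * v (pt (b, a)) b \<noteq> 0"
    and v_pt0: "\<And>b a k. a < b \<Longrightarrow> b < r \<Longrightarrow> k \<noteq> a \<Longrightarrow> k \<noteq> b \<Longrightarrow> v (pt (b, a)) k = 0"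
  proof (rule signed_configuration[OF disj r], goal_cases)
    case (1 v c xs pt)
    show ?case by (rule 1(1)[of c v xs pt]; fact 1)
  qed
  define u0 where "u0 k = (\<chi> i. v i k)" for k
  define J where "J = (SIGMA l:{..<r}. {..l})"
  define A0 where "A0 = (\<Sum>k<r. outer (u0 k))"
  have rankA0: "rank A0 = r"
    unfolding A0_def by (rule rank_sum_outer_eq[OF inj]) (simp add: u0_def v_xs)
  have "A0 \<in> Sym" by (simp add: A0_def Sym_sum)
  then obtain R where R: "rank R + r \<le> CARD('v)" "det (A0 + R) \<noteq> 0"
    using rank_complement_Sym[of A0] rankA0 by metis
  have van: "\<forall>\<^sub>F t in at_right (0::real). f (\<Sum>k<r. outer (u0 k + t *\<^sub>R u k)) = 0"
    if f: "f \<in> F" for f u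
  proof -
    define ut where "ut t k = u0 k + t *\<^sub>R u k" for t k
    define M where "M t = (\<Sum>k<r. outer (ut t k))" for t
    \<comment> \<open>A weight vector is a relation among the tensors of the configuration
      \<open>ut t\<close> exactly if it is orthogonal to all \<open>g j t\<close> with
      \<open>j \<in> J\<close>.\<close>
    define g where "g = (\<lambda>(l, k) t. (\<chi> i. ut t l $ i * ut t k $ i))"
    have g0: "g (l, k) 0 = (\<chi> i. v i l * v i k)" for l k by (simp add: g_def ut_def u0_def)
    have cont: "isCont (g j) 0" for j
      unfolding g_def ut_def isCont_def
      by (cases j) (auto intro!: tendsto_vec_lambda tendsto_eq_intros)
    have indep: "g j 0 \<notin> span ((\<lambda>i. g i 0) ` (J - {j}))" if j: "j \<in> J" for j
    proof -
      obtain l k where lk: "j = (l, k)" "k \<le> l" "l < r" using j by (auto simp: J_def)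
      \<comment> \<open>Independence is shown by a dual vector for each \<open>j\<close>; in other
        words, the tensors span the symmetric matrices.\<close>
      have "\<exists>w. w \<bullet> g j 0 \<noteq> 0 \<and> (\<forall>i\<in>J - {j}. w \<bullet> g i 0 = 0)"
      proof (cases "k = l")
        case True
        have "axis (xs l) 1 \<bullet> g i 0 = 0" if "i \<in> J - {j}" for i
          using that lk True by (cases i) (auto simp: J_def g0 inner_axis' v_xs)
        moreover have "axis (xs l) 1 \<bullet> g j 0 \<noteq> 0" using lk True by (simp add: g0 inner_axis' v_xs)
        ultimately show ?thesis by blast
      next
        case False
        then have kl: "k < l" using lk by simp
        let ?q = "pt (l, k)"
        \<comment> \<open>Evaluation at the vertex of the pair, corrected at two unit vectors to
          remove the squares of its two nonzero coordinates.\<close>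
        define w :: "real^'v" where "w = axis ?q 1 - (v ?q k)\<^sup>2 *\<^sub>R axis (xs k) 1 - (v ?q l)\<^sup>2 *\<^sub>R axis (xs l) 1"
        have w: "w \<bullet> g (b, a) 0 = v ?q b * v ?q a - (v ?q k)\<^sup>2 * (v (xs k) b * v (xs k) a)
            - (v ?q l)\<^sup>2 * (v (xs l) b * v (xs l) a)" for a b
          by (simp add: w_def g0 inner_diff_left inner_axis')
        have "w \<bullet> g i 0 = 0" if i: "i \<in> J - {j}" for i
        proof -
          obtain b a where ba: "i = (b, a)" "a \<le> b" "b < r" "a < r" using i by (auto simp: J_def)
          then have ne: "\<not> (b = l \<and> a = k)" using i lk by auto
          show ?thesis
          proof (cases "a = b")
            case True
            then show ?thesis using ba kl lk v_pt0[OF kl lk(3), of b]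
              by (auto simp: w v_xs power2_eq_square)
          next
            case False
            have "v ?q b * v ?q a = 0"
              using ne False ba(2) kl v_pt0[OF kl lk(3), of b] v_pt0[OF kl lk(3), of a] by fastforce
            then show ?thesis using False ba kl lk by (auto simp: w v_xs)
          qed
        qed
        moreover have "w \<bullet> g j 0 \<noteq> 0"
          using kl lk v_pt[OF kl lk(3)] by (simp add: w v_xs)
        ultimately show ?thesis by blast
      qed
      then obtain w where w: "w \<bullet> g j 0 \<noteq> 0" "\<And>i. i \<in> J - {j} \<Longrightarrow> w \<bullet> g i 0 = 0" by blast
      show ?thesis
      proof
        assume "g j 0 \<in> span ((\<lambda>i. g i 0) ` (J - {j}))"
        then have "orthogonal w (g j 0)"
          by (rule orthogonal_to_span) (use w(2) in \<open>auto simp: orthogonal_def\<close>)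
        then show False using w(1) by (simp add: orthogonal_def)
      qed
    qed
    have orth0: "(\<chi> i. c0 i) \<bullet> g j 0 = 0" if "j \<in> J" for j
      using that bal0 by (auto simp: J_def g0 inner_vec_def)
    have "finite J" by (simp add: J_def)
    then obtain c where c: "isCont c 0" "c 0 = (\<chi> i. c0 i)" "\<And>t j. j \<in> J \<Longrightarrow> c t \<bullet> g j t = 0"
      using continuous_orthogonal_extension[OF _ cont indep orth0] by blast
    have ev_c: "\<forall>\<^sub>F t in at_right 0. (i \<in> X \<longrightarrow> c t $ i < 0) \<and> (i \<in> Y \<longrightarrow> 0 < c t $ i)" for i
    proof -
      have "((\<lambda>t. c t $ i) \<longlongrightarrow> c0 i) (at 0)"
        using tendsto_vec_nth[OF c(1)[unfolded isCont_def], of i] c(2) by simp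
      then have lim: "((\<lambda>t. c t $ i) \<longlongrightarrow> c0 i) (at_right 0)"
        by (rule tendsto_mono[rotated]) (simp add: at_le)
      show ?thesis
        using order_tendstoD[OF lim, of 0] cX[of i] cY[of i] disj
        by (cases "i \<in> X"; cases "i \<in> Y") auto
    qed
    have "real_polynomial_function (\<lambda>t. (M t + R) $ i $ j)" for i j
      unfolding M_def ut_def by (auto simp: outer_def intro!: real_polynomial_function_sum
          real_polynomial_function.intros(2-4) real_polynomial_function.intros(1)[OF bounded_linear_ident])
    then have "isCont (\<lambda>t. det (M t + R)) 0"
      by (intro isCont_real_polynomial_function real_polynomial_function_det)
    moreover have "M 0 = A0" by (simp add: M_def ut_def A0_def)
    ultimately have "((\<lambda>t. det (M t + R)) \<longlongrightarrow> det (A0 + R)) (at 0)" by (simp add: isCont_def)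
    then have "((\<lambda>t. det (M t + R)) \<longlongrightarrow> det (A0 + R)) (at_right 0)"
      by (rule tendsto_mono[rotated]) (simp add: at_le)
    then have ev_det: "\<forall>\<^sub>F t in at_right 0. det (M t + R) \<noteq> 0"
      using R(2) by (rule tendsto_imp_eventually_ne)
    have "\<forall>\<^sub>F t in at_right 0. \<forall>i. (i \<in> X \<longrightarrow> c t $ i < 0) \<and> (i \<in> Y \<longrightarrow> 0 < c t $ i)"
      by (rule eventually_all_finite[OF ev_c])
    then have "\<forall>\<^sub>F t in at_right 0. f (M t) = 0"
      using ev_det
    proof eventually_elim
      case (elim t)
      then have neg: "c t $ i < 0" if "i \<in> X" for i using that by blast
      have pos: "0 < c t $ i" if "i \<in> Y" for i using elim that by blast
      have psd: "pos_semidef (M t)" by (simp add: M_def pos_semidef_sum pos_semidef_outer)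
      then have sym: "M t \<in> Sym" by (simp add: pos_semidef_def)
      have rk: "rank (M t) = r"
      proof (rule antisym)
        show "rank (M t) \<le> r" using rank_sum_outer_le[of "{..<r}" "ut t"] by (simp add: M_def)
        show "r \<le> rank (M t)" using det_add_eq_0[of R "M t"] elim R(1) by linarith
      qed
      have cg: "(\<Sum>i\<in>UNIV. c t $ i * (ut t a $ i * ut t b $ i)) = 0" if "a < r" "b < r" for a b
      proof (cases "b \<le> a")
        case True
        then show ?thesis using c(3)[of "(a, b)" t] that by (simp add: J_def g_def inner_vec_def)
      next
        case False
        then show ?thesis using c(3)[of "(b, a)" t] that
          by (simp add: J_def g_def inner_vec_def mult.commute mult.left_commute)
      qed
      have Mn: "M t $ i $ k = (\<Sum>a<r. ut t a $ i * ut t a $ k)" for i k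
        by (simp add: M_def outer_def)
      \<comment> \<open>Rows of \<open>M t\<close> are linear images of the Gram vectors and inherit
        their quadratic relation.\<close>
      have "(\<Sum>i\<in>UNIV. c t $ i * (M t $ i $ k * M t $ i $ l)) = 0" for k l
      proof -
        have "(\<Sum>i\<in>UNIV. c t $ i * (M t $ i $ k * M t $ i $ l)) =
          (\<Sum>i\<in>UNIV. \<Sum>a<r. \<Sum>b<r. ut t a $ k * ut t b $ l * (c t $ i * (ut t a $ i * ut t b $ i)))"
          unfolding Mn sum_product by (simp add: sum_distrib_left mult_ac)
        also have "\<dots> = (\<Sum>a<r. \<Sum>i\<in>UNIV. \<Sum>b<r. ut t a $ k * ut t b $ l * (c t $ i * (ut t a $ i * ut t b $ i)))"
          by (rule sum.swap)
        also have "\<dots> = (\<Sum>a<r. \<Sum>b<r. \<Sum>i\<in>UNIV. ut t a $ k * ut t b $ l * (c t $ i * (ut t a $ i * ut t b $ i)))"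
          by (intro sum.cong sum.swap refl)
        also have "\<dots> = (\<Sum>a<r. \<Sum>b<r. ut t a $ k * ut t b $ l * (\<Sum>i\<in>UNIV. c t $ i * (ut t a $ i * ut t b $ i)))"
          by (simp only: sum_distrib_left)
        also have "\<dots> = 0" by (simp add: cg)
        finally show ?thesis .
      qed
      then have "(\<Sum>x\<in>X. c t $ x * (M t $ x $ k * M t $ x $ l)) +
          (\<Sum>y\<in>Y. c t $ y * (M t $ y $ k * M t $ y $ l)) = 0" for k l
        by (simp add: sum_bipartition[OF disj cover])
      then have "(\<Sum>x\<in>X. \<bar>c t $ x\<bar> * M t $ x $ k * M t $ x $ l) =
          (\<Sum>y\<in>Y. \<bar>c t $ y\<bar> * M t $ y $ k * M t $ y $ l)" for k l
        using neg pos by (simp add: abs_of_neg abs_of_pos sum_negf mult.assoc add_eq_0_iff2 cong: sum.cong)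
      moreover obtain i0 :: 'v where "0 < \<bar>c t $ i0\<bar>"
        using neg pos cover by (metis UNIV_I Un_iff abs_of_neg abs_of_pos neg_0_less_iff_less)
      ultimately obtain S where "pos_semidef S" "S \<noteq> 0"
        "supported_on (complete_bipartite X Y) S" "S ** M t = 0"
        using stress_exists[OF disj cover sym, of "\<lambda>i. \<bar>c t $ i\<bar>" i0] by auto
      then have "\<not> ?Q (M t)" using stress_imp_no_completion sym by blast
      then show "f (M t) = 0" using bad psd rk f by blast
    qed
    then show ?thesis by (simp add: M_def ut_def)
  qed
  have "f B = 0" if f: "f \<in> F" and B: "B \<in> rank_variety r" for f B
  proof (rule polynomial_vanishing_on_psd[OF F[OF f] _ B])
    fix C :: "real^'v^'v" assume "pos_semidef C" "rank C \<le> r"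
    then obtain u where "C = (\<Sum>k<r. outer (u k))" using pos_semidef_eq_sum_outer by blast
    then show "f C = 0" using polynomial_vanishing_near_gram[OF F[OF f] van[OF f]] by simp
  qed
  then show False using proper by blast
qed

section \<open>Generic completability\<close>

lemma almost_all_completable_Hadamard:
  fixes X Y :: "'v::finite set"
  assumes disj: "X \<inter> Y = {}" and cover: "X \<union> Y = UNIV"
    and r: "card X + card Y \<le> Suc r choose 2"
  shows "almost_all_psd_rank r (\<lambda>A::real^'v^'v.
    \<exists>P. pos_def P \<and> graph_proj (complete_bipartite X Y) A = graph_proj (complete_bipartite X Y) P)"
proof -
  have cardJ: "card (SIGMA b:{..<r}. {..b}) = Suc r choose 2" for r :: nat
  proof -
    have "card (SIGMA b:{..<r}. {..b}) = (\<Sum>b<r. Suc b)" by simp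
    also have "\<dots> = Suc r choose 2" by (induction r) (simp_all add: numeral_2_eq_2)
    finally show ?thesis .
  qed
  have N: "CARD('v) = card X + card Y" using disj cover by (metis card_Un_disjoint finite)
  obtain q :: "'v \<Rightarrow> nat \<times> nat" where q: "q ` UNIV \<subseteq> (SIGMA b:{..<r}. {..b})" "inj q"
    using card_le_inj[of "UNIV :: 'v set" "SIGMA b:{..<r}. {..b}"] r cardJ[of r] N by auto
  \<comment> \<open>Distinct vertices get distinct pairs \<open>a \<le> b < r\<close>, and
    \<open>v i\<close> is the indicator vector of the set \<open>{a, b}\<close>.\<close>
  define v :: "'v \<Rightarrow> nat \<Rightarrow> real" where "v i k = (if k = fst (q i) \<or> k = snd (q i) then 1 else 0)" for i k
  define A0 where "A0 = (\<Sum>k<r. outer (\<chi> i. v i k))"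
  define H where "H A = (\<chi> i j. (A $ i $ j)\<^sup>2)" for A :: "real^'v^'v"
  have qi: "snd (q i) \<le> fst (q i)" "fst (q i) < r" for i
    using q(1) by (auto simp: subset_iff image_iff)
      (metis SigmaE2 prod.collapse lessThan_iff atMost_iff)+
  have "c = 0" if Hc: "H A0 *v c = 0" for c
  proof -
    have "A0 $ i $ j = (\<Sum>k<r. v i k * v j k)" for i j by (simp add: A0_def outer_def)
    then have H0: "H A0 $ i $ j = (\<Sum>k<r. \<Sum>l<r. (v i k * v i l) * (v j k * v j l))" for i j
      by (simp add: H_def power2_eq_square sum_product mult_ac)
    \<comment> \<open>The matrix \<open>s\<close> is the combination of tensors with weights
      \<open>c\<close>; the form of \<open>H A0\<close> at \<open>c\<close> is the sum of its
      squared entries.\<close>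
    define s where "s k l = (\<Sum>i\<in>UNIV. c $ i * (v i k * v i l))" for k l
    have "c \<bullet> (H A0 *v c) = (\<Sum>i\<in>UNIV. \<Sum>j\<in>UNIV. \<Sum>k<r. \<Sum>l<r.
        (c $ i * (v i k * v i l)) * (c $ j * (v j k * v j l)))"
      unfolding inner_vec_def matrix_vector_mult_def H0
      by (simp add: sum_distrib_left sum_distrib_right mult_ac)
    also have "\<dots> = (\<Sum>k<r. \<Sum>l<r. \<Sum>i\<in>UNIV. \<Sum>j\<in>UNIV.
        (c $ i * (v i k * v i l)) * (c $ j * (v j k * v j l)))"
      by (simp add: sum.swap[of _ UNIV "{..<r}"])
    also have "\<dots> = (\<Sum>k<r. \<Sum>l<r. (s k l)\<^sup>2)"
      by (simp add: s_def power2_eq_square sum_product)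
    finally have "(\<Sum>k<r. \<Sum>l<r. (s k l)\<^sup>2) = 0" using Hc by simp
    then have "\<forall>k<r. \<forall>l<r. (s k l)\<^sup>2 = 0" by (simp add: sum_nonneg_eq_0_iff sum_nonneg)
    then have s0: "s k l = 0" if "k < r" "l < r" for k l using that by simp
    have strict: "c $ i = 0" if i: "snd (q i) < fst (q i)" for i
    proof -
      have "s (fst (q i)) (snd (q i)) = (\<Sum>j\<in>UNIV. if j = i then c $ i else 0)"
        unfolding s_def
      proof (rule sum.cong)
        fix j
        show "c $ j * (v j (fst (q i)) * v j (snd (q i))) = (if j = i then c $ i else 0)"
        proof (cases "j = i")
          case False
          then have "q j \<noteq> q i" using q(2) by (auto simp: inj_def)
          then show ?thesis using i qi[of j] False by (auto simp: v_def prod_eq_iff)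
        qed (simp add: v_def)
      qed simp
      then show ?thesis using s0[of "fst (q i)" "snd (q i)"] qi[of i] by simp
    qed
    have "c $ i = 0" for i
    proof (cases "snd (q i) < fst (q i)")
      case False
      then have eq: "snd (q i) = fst (q i)" using qi(1)[of i] by simp
      \<comment> \<open>Vertices with two distinct indices also meet this diagonal entry, but their
        weights are already 0 by the off-diagonal entries.\<close>
      have "s (fst (q i)) (fst (q i)) = (\<Sum>j\<in>UNIV. if j = i then c $ i else 0)"
        unfolding s_def
      proof (rule sum.cong)
        fix j
        show "c $ j * (v j (fst (q i)) * v j (fst (q i))) = (if j = i then c $ i else 0)"
        proof (cases "j = i")
          case False
          then have "q j \<noteq> q i" using q(2) by (auto simp: inj_def)
          then show ?thesis using eq strict[of j] qi(1)[of j] False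
            by (cases "snd (q j) < fst (q j)") (auto simp: v_def prod_eq_iff)
        qed (simp add: v_def)
      qed simp
      then show ?thesis using s0[of "fst (q i)" "fst (q i)"] qi[of i] by simp
    qed (rule strict)
    then show "c = 0" by (simp add: vec_eq_iff)
  qed
  then have det0: "det (H A0) \<noteq> 0"
    by (meson invertible_det_nz invertible_left_inverse matrix_left_invertible_ker)
  show ?thesis
  proof (rule almost_all_psd_rankI)
    show "real_polynomial_function (\<lambda>A. det (H A))"
      by (intro real_polynomial_function_det)
        (simp add: H_def real_polynomial_function_power real_polynomial_function_entry)
    show "A0 \<in> rank_variety r"
      using rank_sum_outer_le[of "{..<r}" "\<lambda>k. \<chi> i. v i k"]
      by (simp add: rank_variety_def A0_def Sym_sum)
    show "det (H A0) \<noteq> 0" by (rule det0)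
    fix A :: "real^'v^'v" assume A: "pos_semidef A" "det (H A) \<noteq> 0"
    then show "\<exists>P. pos_def P \<and> graph_proj (complete_bipartite X Y) A = graph_proj (complete_bipartite X Y) P"
      using stress_eq_0_if_Hadamard_square_regular[OF disj cover, of _ A]
      by (intro no_stress_imp_completion) (auto simp: H_def pos_semidef_def)
  qed
qed

text \<open>Rank \<open>card X + 1\<close> lets the vectors of \<open>X\<close> and of any single
  \<open>y\<close> be independent; the product of the bordered determinants expresses this for all
  \<open>y\<close> at once.\<close>

lemma almost_all_completable_Suc_card:
  fixes X Y :: "'v::finite set"
  assumes disj: "X \<inter> Y = {}" and cover: "X \<union> Y = UNIV" and ne: "Y \<noteq> {}"
  shows "almost_all_psd_rank (Suc (card X)) (\<lambda>A::real^'v^'v.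
    \<exists>P. pos_def P \<and> graph_proj (complete_bipartite X Y) A = graph_proj (complete_bipartite X Y) P)"
proof (rule almost_all_psd_rankI)
  \<comment> \<open>The Gram matrix of an orthonormal family indexed by \<open>X\<close> and one
    further orthonormal vector shared by all of \<open>Y\<close>.\<close>
  define A0 where "A0 = (\<Sum>x\<in>X. outer (axis x 1)) + outer (\<chi> i. if i \<in> Y then 1 else 0)"
  have A0_nth: "A0 $ i $ j = (if i = j \<and> i \<in> X then 1 else if i \<in> Y \<and> j \<in> Y then 1 else 0)" for i j
  proof -
    have "(\<Sum>x\<in>X. axis x (1::real) $ i * axis x 1 $ j) = (\<Sum>x\<in>X. if x = i then (if i = j then 1 else 0) else 0)"
      by (intro sum.cong) (auto simp: axis_def)
    then show ?thesis using disj by (auto simp: A0_def outer_def)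
  qed
  have "border X y A0 = mat 1" if "y \<in> Y" for y
    using that disj by (auto simp: vec_eq_iff border_def A0_nth mat_def)
  then show "(\<Prod>y\<in>Y. det (border X y A0)) \<noteq> 0" by simp
  show "real_polynomial_function (\<lambda>A. \<Prod>y\<in>Y. det (border X y A))"
  proof (intro real_polynomial_function_prod real_polynomial_function_det)
    fix y i j
    show "real_polynomial_function (\<lambda>A. border X y A $ i $ j)"
      by (cases "i \<in> insert y X \<and> j \<in> insert y X")
        (auto simp: border_def real_polynomial_function_entry real_polynomial_function.intros(2))
  qed simp
  show "A0 \<in> rank_variety (Suc (card X))"
  proof -
    have "A0 \<in> Sym" by (rule SymI) (auto simp: A0_nth)
    moreover have "rank A0 \<le> Suc (card X)"
      unfolding A0_def
      using rank_add_le[of "\<Sum>x\<in>X. outer (axis x 1)" "outer (\<chi> i. if i \<in> Y then 1 else 0)"]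
        rank_sum_outer_le[of X "\<lambda>x. axis x 1"] rank_outer_le[of "\<chi> i. if i \<in> Y then 1 else 0"]
      by simp
    ultimately show ?thesis by (simp add: rank_variety_def)
  qed
  fix A :: "real^'v^'v" assume A: "pos_semidef A" "(\<Prod>y\<in>Y. det (border X y A)) \<noteq> 0"
  then show "\<exists>P. pos_def P \<and> graph_proj (complete_bipartite X Y) A = graph_proj (complete_bipartite X Y) P"
    using stress_eq_0_if_border_regular[OF disj cover, of _ A] ne
    by (intro no_stress_imp_completion) (auto simp: pos_semidef_def)
qed

section \<open>The threshold of the complete bipartite graph\<close>

theorem theorem2p7:
  fixes X Y :: "'v::finite set" and m n :: nat
  assumes "X \<inter> Y = {}" and "X \<union> Y = UNIV"
    and "card X = m" and "card Y = n"
    and "2 \<le> m" and "m \<le> n"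
  shows "mlt (complete_bipartite X Y) = min (LEAST k. m + n \<le> (k + 1) choose 2) (m + 1)"
proof -
  define M where "M = (LEAST k. m + n \<le> (k + 1) choose 2)"
  \<comment> \<open>The number \<open>m + n\<close> satisfies the inequality, so the minimum is
    attained.\<close>
  have "m + n \<le> (m + n + 1) choose 2"
    using assms(5) by (simp add: numeral_2_eq_2)
  then have M: "m + n \<le> (M + 1) choose 2" unfolding M_def by (rule LeastI)
  have less_M: "(k + 1) choose 2 < m + n" if "k < M" for k
    using not_less_Least[of k "\<lambda>k. m + n \<le> (k + 1) choose 2"] that by (simp add: M_def)
  show ?thesis
    unfolding mlt_def M_def[symmetric]
  proof (rule Least_equality)
    have "Y \<noteq> {}" using assms by auto
    then show "almost_all_psd_rank (min M (m + 1)) (\<lambda>A::real^'v^'v. \<exists>P. pos_def P \<and>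
        graph_proj (complete_bipartite X Y) A = graph_proj (complete_bipartite X Y) P)"
      using almost_all_completable_Hadamard[OF assms(1,2), of M] M
        almost_all_completable_Suc_card[OF assms(1,2)] assms(3,4) by (auto simp: min_def)
    fix r assume r: "almost_all_psd_rank r (\<lambda>A::real^'v^'v. \<exists>P. pos_def P \<and>
        graph_proj (complete_bipartite X Y) A = graph_proj (complete_bipartite X Y) P)"
    show "min M (m + 1) \<le> r"
    proof (rule ccontr)
      assume "\<not> ?thesis"
      \<comment> \<open>Minimality of \<open>M\<close> gives too few tensor dimensions for
        independence, and \<open>r \<le> m \<le> n\<close> leaves \<open>r\<close> vertices on
        either side for the configuration.\<close>
      then have "r < M" "r \<le> m" by auto
      then show False
        using r not_almost_all_completable[OF assms(1,2), of r] less_M[of r] assms(3,4,6) by simp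
    qed
  qed
qed

end
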